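(* Let $2\le h\le k'\le k<n$ be integers and let $V$ be an $h$-non-involutive $k$-dimensional distribution of planes of class $C^1$ in $\mathbb{R}^n$. Let $S$ be a submanifold of $\mathbb{R}^n$ of dimension $k'$ and of class $C^2$. Then the set $$\mathscr{C}(S,V):=\{q\in S:\ \mathrm{Tan}(S,q)\subseteq V(q)\},$$ where $\mathrm{Tan}(S,q)$ is the classical tangent space to $S$ at $q$, is $(h-1)$-rectifiable.
   Context: A $k$-dimensional distribution of planes in $\mathbb{R}^n$ is a map $V:\mathbb{R}^n\to\mathrm{Gr}(n,k)$ (the Grassmannian of $k$-dimensional linear subspaces of $\mathbb{R}^n$). It is of class $C^r$ if there are vector fields $X_1,\dots,X_k$ of class $C^r$ on $\mathbb{R}^n$ with $V(x)=\mathrm{span}\{X_1(x),\dots,X_k(x)\}$ for every $x$. A vector field $Y$ is tangent to $V$ if $Y(x)\in V(x)$ for every $x$; a distribution $W$ is tangent to $V$ if it is spanned by vector fields tangent to $V$, i.e. $W(x)\subseteq V(x)$ for every $x$. These notions are also used locally, on open neighbourhoods of a point. A $C^1$ distribution $W$ is non-involutive at a point $x$ if there are $C^1$ vector fields $X,X'$ tangent to $W$ such that the Lie bracket $[X,X'](x)$ does not belong to $W(x)$. For $h\le k$, a $k$-dimensional $C^1$ distribution $V$ is $h$-non-involutive at $x$ if every $h$-dimensional distribution of class $C^1$ tangent to $V$ (defined near $x$) is non-involutive at $x$; $V$ is $h$-non-involutive if this holds at every point $x\in\mathbb{R}^n$. An $\mathscr{H}^p$-measurable set $E\subseteq\mathbb{R}^n$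 is $p$-rectifiable if there are countably many compact sets $K_i\subseteq\mathbb{R}^p$ and Lipschitz maps $f_i:K_i\to\mathbb{R}^n$ with $\mathscr{H}^p(E\setminus\bigcup_i f_i(K_i))=0$, where $\mathscr{H}^p$ is the $p$-dimensional Euclidean Hausdorff measure. *)

theory Defs
  imports "HOL-Analysis.Analysis"
begin

section \<open>Maps of class \<open>C\<^sup>r\<close>\<close>

text \<open>
  Meant for open \<open>U\<close>. Iterating over directional derivatives keeps the codomain fixed; in finite
  dimension, continuity of all directional derivatives is the same as continuity of the Frechet
  derivative as a map into the space of linear maps.
\<close>

primrec Cr_on :: "nat \<Rightarrow> 'a::euclidean_space set \<Rightarrow> ('a \<Rightarrow> 'b::euclidean_space) \<Rightarrow> bool" where
  "Cr_on 0 U f \<longleftrightarrow> continuous_on U f"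
| "Cr_on (Suc r) U f \<longleftrightarrow> (\<forall>x\<in>U. f differentiable (at x)) \<and>
     (\<forall>v. Cr_on r U (\<lambda>x. frechet_derivative f (at x) v))"

section \<open>Distributions of planes\<close>

definition distribution_on ::
  "nat \<Rightarrow> 'a::euclidean_space set \<Rightarrow> nat \<Rightarrow> ('a \<Rightarrow> 'a set) \<Rightarrow> bool" where
  "distribution_on r U k V \<longleftrightarrow>
     (\<forall>x\<in>U. subspace (V x) \<and> dim (V x) = k) \<and>
     (\<exists>X :: nat \<Rightarrow> 'a \<Rightarrow> 'a. (\<forall>i\<in>{1..k}. Cr_on r U (X i)) \<and>
        (\<forall>x\<in>U. V x = span ((\<lambda>i. X i x) ` {1..k})))"

definition tangent_field_on :: "'a set \<Rightarrow> ('a \<Rightarrow> 'a) \<Rightarrow> ('a \<Rightarrow> 'a set) \<Rightarrow> bool" where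
  "tangent_field_on U Y V \<longleftrightarrow> (\<forall>x\<in>U. Y x \<in> V x)"

definition tangent_distribution_on :: "'a set \<Rightarrow> ('a \<Rightarrow> 'a set) \<Rightarrow> ('a \<Rightarrow> 'a set) \<Rightarrow> bool" where
  "tangent_distribution_on U W V \<longleftrightarrow> (\<forall>x\<in>U. W x \<subseteq> V x)"

definition lie_bracket ::
  "('a::euclidean_space \<Rightarrow> 'a) \<Rightarrow> ('a \<Rightarrow> 'a) \<Rightarrow> 'a \<Rightarrow> 'a" where
  "lie_bracket X Y x = frechet_derivative Y (at x) (X x) - frechet_derivative X (at x) (Y x)"

text \<open>
  A distribution given only on an open set \<open>U\<close> is a total function whose values outside \<open>U\<close> are
  irrelevant; hence \<open>U\<close> is a parameter, and the vector fields live on a neighbourhood of \<open>x\<close>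
  inside \<open>U\<close>.
\<close>

definition non_involutive_at ::
  "'a::euclidean_space set \<Rightarrow> ('a \<Rightarrow> 'a set) \<Rightarrow> 'a \<Rightarrow> bool" where
  "non_involutive_at U W x \<longleftrightarrow>
     (\<exists>N X Y. open N \<and> x \<in> N \<and> N \<subseteq> U \<and> Cr_on 1 N X \<and> Cr_on 1 N Y \<and>
        tangent_field_on N X W \<and> tangent_field_on N Y W \<and> lie_bracket X Y x \<notin> W x)"

definition h_non_involutive_at ::
  "nat \<Rightarrow> ('a::euclidean_space \<Rightarrow> 'a set) \<Rightarrow> 'a \<Rightarrow> bool" where
  "h_non_involutive_at h V x \<longleftrightarrow>
     (\<forall>U W. open U \<and> x \<in> U \<and> distribution_on 1 U h W \<and> tangent_distribution_on U W V \<longrightarrow>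
        non_involutive_at U W x)"

definition h_non_involutive :: "nat \<Rightarrow> ('a::euclidean_space \<Rightarrow> 'a set) \<Rightarrow> bool" where
  "h_non_involutive h V \<longleftrightarrow> (\<forall>x. h_non_involutive_at h V x)"

section \<open>Submanifolds and the tangency set\<close>

text \<open>
  Embedded submanifolds without boundary: locally, a \<open>C\<^sup>r\<close> diffeomorphism \<open>\<Phi>\<close> of open sets (with
  inverse \<open>\<Psi>\<close>) flattens \<open>S\<close> to a \<open>d\<close>-dimensional linear subspace \<open>L\<close>.
\<close>

definition submanifold :: "nat \<Rightarrow> nat \<Rightarrow> 'a::euclidean_space set \<Rightarrow> bool" where
  "submanifold r d S \<longleftrightarrow>
     (\<forall>q\<in>S. \<exists>U (\<Phi> :: 'a \<Rightarrow> 'a) (\<Psi> :: 'a \<Rightarrow> 'a) L.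
        open U \<and> q \<in> U \<and> open (\<Phi> ` U) \<and>
        Cr_on r U \<Phi> \<and> Cr_on r (\<Phi> ` U) \<Psi> \<and> (\<forall>x\<in>U. \<Psi> (\<Phi> x) = x) \<and>
        subspace L \<and> dim L = d \<and> \<Phi> ` (S \<inter> U) = \<Phi> ` U \<inter> L)"

text \<open>Velocities at \<open>q\<close> of \<open>C\<^sup>1\<close> curves in \<open>S\<close>.\<close>

definition Tan :: "'a::euclidean_space set \<Rightarrow> 'a \<Rightarrow> 'a set" where
  "Tan S q = {v. \<exists>(\<gamma> :: real \<Rightarrow> 'a) \<epsilon>. 0 < \<epsilon> \<and> \<gamma> C1_differentiable_on {-\<epsilon><..<\<epsilon>} \<and>
     \<gamma> ` {-\<epsilon><..<\<epsilon>} \<subseteq> S \<and> \<gamma> 0 = q \<and> (\<gamma> has_vector_derivative v) (at 0)}"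

definition tangency_set ::
  "'a::euclidean_space set \<Rightarrow> ('a \<Rightarrow> 'a set) \<Rightarrow> 'a set" where
  "tangency_set S V = {q \<in> S. Tan S q \<subseteq> V q}"

section \<open>Hausdorff measure and rectifiability\<close>

text \<open>
  The covering sets have to be bounded because \<^const>\<open>diameter\<close> has no meaningful value on unbounded
  sets. The empty set has weight \<open>0\<close> also for \<open>p = 0\<close>, where \<open>0 ^ 0 = 1\<close>.
\<close>

definition hausdorff_weight :: "nat \<Rightarrow> 'a::euclidean_space set \<Rightarrow> ennreal" where
  "hausdorff_weight p C =
     (if C = {} then 0 else ennreal (unit_ball_vol (real p) * (diameter C / 2) ^ p))"

definition hausdorff_content :: "nat \<Rightarrow> real \<Rightarrow> 'a::euclidean_space set \<Rightarrow> ennreal" where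
  "hausdorff_content p \<delta> E =
     (INF C \<in> {C :: nat \<Rightarrow> 'a set. E \<subseteq> (\<Union>i. C i) \<and> (\<forall>i. bounded (C i) \<and> diameter (C i) \<le> \<delta>)}.
        \<Sum>i. hausdorff_weight p (C i))"

definition hausdorff_measure :: "nat \<Rightarrow> 'a::euclidean_space set \<Rightarrow> ennreal" where
  "hausdorff_measure p E = (SUP \<delta> \<in> {0<..}. hausdorff_content p \<delta> E)"

text \<open>Caratheodory measurability for the outer measure \<open>hausdorff_measure p\<close>.\<close>

definition hausdorff_measurable :: "nat \<Rightarrow> 'a::euclidean_space set \<Rightarrow> bool" where
  "hausdorff_measurable p E \<longleftrightarrow> E \<in> lambda_system UNIV UNIV (hausdorff_measure p)"

text \<open>\<open>p\<close>-rectifiability, where \<open>p\<close> is the cardinality of the index type of the parameter space.\<close>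

definition rectifiable :: "'p::finite itself \<Rightarrow> 'a::euclidean_space set \<Rightarrow> bool" where
  "rectifiable _ E \<longleftrightarrow>
     hausdorff_measurable CARD('p) E \<and>
     (\<exists>(K :: nat \<Rightarrow> (real ^ 'p) set) (f :: nat \<Rightarrow> real ^ 'p \<Rightarrow> 'a).
        (\<forall>i. compact (K i) \<and> (\<exists>L. L-lipschitz_on (K i) (f i))) \<and>
        hausdorff_measure CARD('p) (E - (\<Union>i. f i ` K i)) = 0)"

end

theory Submission
  imports Defs
begin

text \<open>
  Near a point \<open>q\<close> of the tangency set, a \<open>C\<^sup>2\<close> diffeomorphism \<open>\<Phi>\<close> with inverse \<open>\<Psi>\<close> flattens \<open>S\<close> to a
  subspace \<open>L\<close>, and the tangent space of \<open>S\<close> at \<open>\<Psi> y\<close> is \<open>D\<Psi>(y) L\<close>. Let \<open>P x\<close> be a projection onto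
  \<open>V x\<close> that depends on \<open>x\<close> in a \<open>C\<^sup>1\<close> way. Then the tangency set is, in the chart, the common zero set
  in \<open>L\<close> of the \<open>C\<^sup>1\<close> maps \<open>defect t y = D\<Psi>(y) t - P(\<Psi> y) (D\<Psi>(y) t)\<close>, \<open>t \<in> L\<close>.

  The heart of the matter is that the derivatives of these maps at \<open>y\<^sub>0 = \<Phi> q\<close> have a common kernel
  in \<open>L\<close> of dimension less than \<open>h\<close>. Otherwise the kernel contains an \<open>h\<close>-dimensional subspace \<open>T\<close>. The
  projected coordinate fields \<open>A x t = P x (D\<Psi>(\<Phi> x) t)\<close>, \<open>t \<in> T\<close>, span near \<open>q\<close> an \<open>h\<close>-dimensional
  \<open>C\<^sup>1\<close> distribution tangent to \<open>V\<close>. They agree at \<open>q\<close> to first order, in directions of \<open>D\<Psi>(y\<^sub>0) T\<close>,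
  with the unprojected fields \<open>D\<Psi>(\<Phi> x) t\<close>, because the defect and its derivative vanish there. The
  unprojected fields commute by the symmetry of \<open>D\<^sup>2\<Psi>\<close>, so the projected fields have vanishing brackets
  at \<open>q\<close>. Since the bracket modulo a distribution depends only on the values of the fields at the point
  (\<open>lie_bracket_tensorial\<close>), the distribution is involutive at \<open>q\<close>, against the hypothesis on \<open>V\<close>.

  A common zero set in \<open>L\<close> of \<open>C\<^sup>1\<close> maps whose derivatives have a common kernel of dimension at most
  \<open>h - 1\<close> is near \<open>y\<^sub>0\<close> a compact set on which a linear map to \<open>\<real>\<^sup>h\<^sup>-\<^sup>1\<close> has a Lipschitz inverse
  (\<open>zero_set_lipschitz_chart\<close>). Hence the tangency set is a countable union of Lipschitz images of
  compact sets of that dimension, with nothing left over. It is measurable because the Hausdorff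
  measure is a metric outer measure, for which closed sets are Caratheodory measurable.
\<close>

section \<open>The Hausdorff measure as a metric outer measure\<close>

lemma hausdorff_weight_empty [simp]: "hausdorff_weight p {} = 0"
  by (simp add: hausdorff_weight_def)

lemma hausdorff_weight_mono:
  assumes "A \<subseteq> B" "bounded B"
  shows "hausdorff_weight p A \<le> hausdorff_weight p B"
proof -
  have "diameter A \<le> diameter B" using assms by (rule diameter_subset)
  moreover have "0 \<le> diameter A"
    using assms by (meson bounded_subset diameter_ge_0)
  ultimately show ?thesis
    using assms(1) unfolding hausdorff_weight_def
    by (auto intro!: ennreal_leI mult_left_mono power_mono)
qed

lemma hausdorff_content_le:
  assumes "E \<subseteq> (\<Union>i. C i)" "\<And>i. bounded (C i)" "\<And>i. diameter (C i) \<le> \<delta>"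
  shows "hausdorff_content p \<delta> E \<le> (\<Sum>i. hausdorff_weight p (C i))"
  unfolding hausdorff_content_def by (rule INF_lower) (use assms in auto)

lemma hausdorff_content_mono:
  "A \<subseteq> B \<Longrightarrow> hausdorff_content p \<delta> A \<le> hausdorff_content p \<delta> B"
  unfolding hausdorff_content_def by (rule INF_superset_mono) auto

lemma hausdorff_content_antimono:
  "\<delta> \<le> \<delta>' \<Longrightarrow> hausdorff_content p \<delta>' A \<le> hausdorff_content p \<delta> A"
  unfolding hausdorff_content_def by (rule INF_superset_mono) (auto intro: order_trans)

text \<open>
  Near-optimal covers of the \<open>A n\<close>, with errors that form a convergent geometric series, are merged
  into one sequence along \<open>prod_decode\<close>.
\<close>

lemma hausdorff_content_countably_subadditive:
  fixes A :: "nat \<Rightarrow> 'a::euclidean_space set"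
  shows "hausdorff_content p \<delta> (\<Union>n. A n) \<le> (\<Sum>n. hausdorff_content p \<delta> (A n))"
proof (rule ennreal_le_epsilon)
  let ?ok = "\<lambda>n C. A n \<subseteq> (\<Union>i. C i) \<and> (\<forall>i. bounded (C i) \<and> diameter (C i) \<le> \<delta>)"
  let ?h = "hausdorff_content p \<delta>"
  fix e :: real assume e: "0 < e" and "(\<Sum>n. ?h (A n)) < top"
  then have *: "?h (A n) < ?h (A n) + e * (1/2)^Suc n" for n
    by (auto simp: less_top dest!: ennreal_suminf_lessD)
  have "\<exists>C. ?ok n C \<and> (\<Sum>i. hausdorff_weight p (C i)) < ?h (A n) + e * (1/2)^Suc n" for n
    using * [of n] unfolding hausdorff_content_def INF_less_iff by auto
  then obtain B where B: "\<And>n. ?ok n (B n)"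
    and Ble: "\<And>n. (\<Sum>i. hausdorff_weight p (B n i)) \<le> ?h (A n) + e * (1/2)^Suc n"
    by (metis less_imp_le)
  define C where "C = case_prod B \<circ> prod_decode"
  have "(\<Union>n. A n) \<subseteq> (\<Union>i. C i)"
  proof
    fix x assume "x \<in> (\<Union>n. A n)"
    then obtain n i where "x \<in> B n i" using B by blast
    then have "x \<in> C (prod_encode (n, i))" by (simp add: C_def)
    then show "x \<in> (\<Union>i. C i)" by blast
  qed
  moreover have "bounded (C i)" "diameter (C i) \<le> \<delta>" for i
    using B by (auto simp: C_def split: prod.splits)
  ultimately have "?h (\<Union>n. A n) \<le> (\<Sum>i. hausdorff_weight p (C i))"
    by (rule hausdorff_content_le)
  also have "\<dots> = (\<Sum>n. \<Sum>i. hausdorff_weight p (B n i))"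
  proof -
    have "(\<Sum>i. (case_prod (\<lambda>n i. hausdorff_weight p (B n i)) \<circ> prod_decode) i)
        = (\<Sum>n. \<Sum>i. hausdorff_weight p (B n i))"
      unfolding comp_def by (rule suminf_ennreal_2dimen) auto
    moreover have "(\<lambda>i. hausdorff_weight p (C i))
        = case_prod (\<lambda>n i. hausdorff_weight p (B n i)) \<circ> prod_decode"
      by (auto simp: C_def fun_eq_iff split: prod.splits)
    ultimately show ?thesis by (simp only:)
  qed
  also have "\<dots> \<le> (\<Sum>n. ?h (A n) + e * (1/2) ^ Suc n)"
    by (intro suminf_le Ble) auto
  also have "\<dots> = (\<Sum>n. ?h (A n)) + (\<Sum>n. ennreal e * ennreal ((1/2) ^ Suc n))"
    using e by (subst suminf_add[symmetric])
               (auto simp del: ennreal_suminf_cmult simp add: ennreal_mult[symmetric])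
  also have "\<dots> = (\<Sum>n. ?h (A n)) + e"
    unfolding ennreal_suminf_cmult
    by (subst suminf_ennreal_eq[OF zero_le_power power_half_series]) auto
  finally show "?h (\<Union>n. A n) \<le> (\<Sum>n. ?h (A n)) + e" .
qed

lemma hausdorff_content_le_measure:
  "0 < \<delta> \<Longrightarrow> hausdorff_content p \<delta> E \<le> hausdorff_measure p E"
  unfolding hausdorff_measure_def by (rule SUP_upper) auto

lemma hausdorff_measure_mono:
  "A \<subseteq> B \<Longrightarrow> hausdorff_measure p A \<le> hausdorff_measure p B"
  unfolding hausdorff_measure_def by (rule SUP_mono) (auto intro: hausdorff_content_mono)

lemma hausdorff_measure_empty [simp]: "hausdorff_measure p {} = 0"
proof -
  have "hausdorff_content p \<delta> {} = 0" if "0 < \<delta>" for \<delta>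
    using hausdorff_content_le[of "{}" "\<lambda>_. {}" \<delta> p] that by simp
  then show ?thesis unfolding hausdorff_measure_def
    by (intro antisym SUP_least) auto
qed

lemma hausdorff_measure_countably_subadditive:
  "hausdorff_measure p (\<Union>n::nat. A n) \<le> (\<Sum>n. hausdorff_measure p (A n))"
  unfolding hausdorff_measure_def[of p "\<Union>n. A n"]
proof (rule SUP_least)
  fix \<delta> :: real assume "\<delta> \<in> {0<..}"
  have "hausdorff_content p \<delta> (\<Union>n. A n) \<le> (\<Sum>n. hausdorff_content p \<delta> (A n))"
    by (rule hausdorff_content_countably_subadditive)
  also have "\<dots> \<le> (\<Sum>n. hausdorff_measure p (A n))"
    using \<open>\<delta> \<in> {0<..}\<close> by (intro suminf_le hausdorff_content_le_measure) auto
  finally show "hausdorff_content p \<delta> (\<Union>n. A n) \<le> (\<Sum>n. hausdorff_measure p (A n))" .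
qed

lemma outer_measure_space_hausdorff: "outer_measure_space UNIV (hausdorff_measure p)"
  unfolding outer_measure_space_def positive_def increasing_def countably_subadditive_def
  by (simp add: hausdorff_measure_mono hausdorff_measure_countably_subadditive)

lemma sigma_algebra_hausdorff_measurable:
  "sigma_algebra UNIV {E :: 'a::euclidean_space set. hausdorff_measurable p E}"
proof -
  have "sigma_algebra (UNIV :: 'a set) UNIV"
    using sigma_algebra_Pow[of "UNIV :: 'a set"] by simp
  from sigma_algebra.caratheodory_lemma[OF this outer_measure_space_hausdorff]
  show ?thesis
    by (simp add: measure_space_def hausdorff_measurable_def)
qed

lemma hausdorff_measure_Un_le:
  "hausdorff_measure p (A \<union> B) \<le> hausdorff_measure p A + hausdorff_measure p B"
proof -
  have "(\<Union>n. binaryset A B n) = A \<union> B" by (rule UN_binaryset_eq)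
  moreover have "(\<Sum>n. hausdorff_measure p (binaryset A B n))
      = hausdorff_measure p A + hausdorff_measure p B"
    by (rule suminf_binaryset_eq) simp
  ultimately show ?thesis
    using hausdorff_measure_countably_subadditive[of p "binaryset A B"] by simp
qed

text \<open>
  A covering set of diameter below \<open>\<rho>\<close> cannot meet both \<open>A\<close> and \<open>B\<close>, so each fine cover of \<open>A \<union> B\<close> splits
  into covers of the two parts without additional weight.
\<close>

lemma hausdorff_measure_Un_separated:
  assumes \<rho>: "0 < \<rho>" and sep: "\<And>a b. a \<in> A \<Longrightarrow> b \<in> B \<Longrightarrow> \<rho> \<le> dist a b"
  shows "hausdorff_measure p A + hausdorff_measure p B \<le> hausdorff_measure p (A \<union> B)"
proof -
  have *: "hausdorff_content p \<delta> A + hausdorff_content p \<delta> B \<le> hausdorff_content p \<delta> (A \<union> B)"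
    if \<delta>: "\<delta> < \<rho>" for \<delta>
    unfolding hausdorff_content_def[of p \<delta> "A \<union> B"]
  proof (rule INF_greatest, clarify)
    fix C :: "nat \<Rightarrow> _" 
    assume C: "A \<union> B \<subseteq> (\<Union>i. C i)" "\<forall>i. bounded (C i) \<and> diameter (C i) \<le> \<delta>"
    have wt: "hausdorff_weight p (C i \<inter> A) + hausdorff_weight p (C i \<inter> B)
        \<le> hausdorff_weight p (C i)" for i
    proof -
      have "C i \<inter> A = {} \<or> C i \<inter> B = {}"
      proof (rule ccontr)
        assume "\<not> ?thesis"
        then obtain a b where ab: "a \<in> C i" "a \<in> A" "b \<in> C i" "b \<in> B" by blast
        then have "dist a b \<le> diameter (C i)" using C diameter_bounded_bound by blast
        moreover have "\<rho> \<le> dist a b" "diameter (C i) \<le> \<delta>" using ab C sep by auto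
        ultimately show False using \<delta> by linarith
      qed
      then show ?thesis
        using C by (elim disjE) (auto intro: hausdorff_weight_mono)
    qed
    have small: "bounded (C i \<inter> X)" "diameter (C i \<inter> X) \<le> \<delta>" for i X
      using C diameter_subset[of "C i \<inter> X" "C i"]
      by (auto intro: bounded_subset order_trans)
    have "hausdorff_content p \<delta> A + hausdorff_content p \<delta> B
        \<le> (\<Sum>i. hausdorff_weight p (C i \<inter> A)) + (\<Sum>i. hausdorff_weight p (C i \<inter> B))"
      using C by (intro add_mono hausdorff_content_le small) auto
    also have "\<dots> = (\<Sum>i. hausdorff_weight p (C i \<inter> A) + hausdorff_weight p (C i \<inter> B))"
      by (rule suminf_add) auto
    also have "\<dots> \<le> (\<Sum>i. hausdorff_weight p (C i))"
      by (intro suminf_le wt) auto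
    finally show "hausdorff_content p \<delta> A + hausdorff_content p \<delta> B
        \<le> (\<Sum>i. hausdorff_weight p (C i))" .
  qed
  have "hausdorff_measure p A + hausdorff_measure p B
      = (SUP \<delta> \<in> {0<..}. hausdorff_content p \<delta> A + hausdorff_content p \<delta> B)"
    unfolding hausdorff_measure_def
  proof (rule SUP_add_directed_ennreal[symmetric])
    fix i j :: real assume ij: "i \<in> {0<..}" "j \<in> {0<..}"
    show "\<exists>k\<in>{0<..}. hausdorff_content p i A + hausdorff_content p j B
        \<le> hausdorff_content p k A + hausdorff_content p k B"
      using ij by (intro bexI[of _ "min i j"] add_mono hausdorff_content_antimono) auto
  qed
  also have "\<dots> \<le> hausdorff_measure p (A \<union> B)"
  proof (rule SUP_least)
    fix \<delta> :: real assume \<delta>: "\<delta> \<in> {0<..}"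
    \<comment> \<open>Separation is only visible at scales below \<open>\<rho>\<close>.\<close>
    define \<delta>' where "\<delta>' = min \<delta> (\<rho>/2)"
    have "hausdorff_content p \<delta> A + hausdorff_content p \<delta> B
        \<le> hausdorff_content p \<delta>' A + hausdorff_content p \<delta>' B"
      by (intro add_mono hausdorff_content_antimono) (auto simp: \<delta>'_def)
    also have "\<dots> \<le> hausdorff_content p \<delta>' (A \<union> B)"
      using \<rho> by (intro *) (auto simp: \<delta>'_def)
    also have "\<dots> \<le> hausdorff_measure p (A \<union> B)"
      using \<rho> \<delta> by (intro hausdorff_content_le_measure) (auto simp: \<delta>'_def)
    finally show "hausdorff_content p \<delta> A + hausdorff_content p \<delta> B
        \<le> hausdorff_measure p (A \<union> B)" .
  qed
  finally show ?thesis .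
qed

text \<open>
  Caratheodory's criterion for metric outer measures. The points of \<open>A\<close> at distance at least
  \<open>1 / (n + 1)\<close> from \<open>F\<close> form a set \<open>N n\<close> separated from \<open>F\<close>, so \<open>A \<inter> F\<close> and \<open>N n\<close> add up to at most the
  measure of \<open>A\<close>. It remains to replace \<open>N n\<close> by \<open>A - F\<close>; the difference is a union of the layers
  \<open>R k\<close> with \<open>k \<ge> n\<close>, and the measures of all layers have a finite sum since the layers with odd index
  are separated from one another, as are those with even index.
\<close>

lemma hausdorff_measurable_closed:
  fixes F :: "'a::euclidean_space set"
  assumes "closed F"
  shows "hausdorff_measurable p F"
proof (cases "F = {}")
  case True
  interpret sigma_algebra UNIV "{E :: 'a set. hausdorff_measurable p E}"
    by (rule sigma_algebra_hausdorff_measurable)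
  show ?thesis using True empty_sets by simp
next
  case False
  let ?H = "hausdorff_measure p"
  have "?H (A \<inter> F) + ?H (A - F) \<le> ?H A" for A
  proof (cases "?H A = top")
    case False
    \<comment> \<open>The offset 1 avoids division by zero at \<open>n = 0\<close>.\<close>
    define N where "N n = {x \<in> A. 1 / (real n + 1) \<le> infdist x F}" for n
    define R where "R n = N (Suc n) - N n" for n
    have Nmono: "N m \<subseteq> N n" if "m \<le> n" for m n
    proof -
      have "1 / (real n + 1) \<le> 1 / (real m + 1)" using that by (simp add: frac_le)
      then show ?thesis by (auto simp: N_def)
    qed
    have AF: "A - F = (\<Union>n. N n)"
    proof (intro equalityI subsetI)
      fix x assume x: "x \<in> A - F"
      then have "0 < infdist x F"
        using \<open>F \<noteq> {}\<close> assms by (metis DiffD2 in_closed_iff_infdist_zero infdist_nonneg less_eq_real_def)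
      then obtain n where "1 / (real n + 1) < infdist x F"
        using reals_Archimedean by (metis of_nat_Suc inverse_eq_divide add.commute)
      with x have "x \<in> N n" by (auto simp: N_def)
      then show "x \<in> (\<Union>n. N n)" by blast
    next
      fix x assume "x \<in> (\<Union>n. N n)"
      then obtain n where n: "x \<in> A" "1 / (real n + 1) \<le> infdist x F" by (auto simp: N_def)
      have "0 < 1 / (real n + 1)" by simp
      with n have "infdist x F \<noteq> 0" by linarith
      then show "x \<in> A - F" using n by auto
    qed
    have ANF: "?H (A \<inter> F) + ?H (N n) \<le> ?H A" for n
    proof -
      have "?H (A \<inter> F) + ?H (N n) \<le> ?H (A \<inter> F \<union> N n)"
      proof (rule hausdorff_measure_Un_separated)
        fix a b assume "a \<in> A \<inter> F" "b \<in> N n"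
        then show "1 / (real n + 1) \<le> dist a b"
          using infdist_le[of a F b] by (auto simp: N_def dist_commute intro: order_trans)
      qed simp
      also have "\<dots> \<le> ?H A" by (intro hausdorff_measure_mono) (auto simp: N_def)
      finally show ?thesis .
    qed
    \<comment> \<open>Layer \<open>s + 1\<close> keeps a positive distance \<open>\<rho>\<close> from \<open>N s\<close>, which contains all layers below \<open>s\<close>.\<close>
    have layers: "(\<Sum>k<m. ?H (R (2 * k + c + 1))) \<le> ?H (N (2 * m + c))" for m c
    proof (induction m)
      case (Suc m)
      define s where "s = 2 * m + c"
      define \<rho> where "\<rho> = 1 / (real s + 1) - 1 / (real s + 2)"
      have "(\<Sum>k<Suc m. ?H (R (2 * k + c + 1))) \<le> ?H (N s) + ?H (R (s + 1))"
        using Suc.IH by (simp add: s_def add_right_mono)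
      also have "\<dots> \<le> ?H (N s \<union> R (s + 1))"
      proof (rule hausdorff_measure_Un_separated)
        have "1 / (real s + 2) < 1 / (real s + 1)" by (intro divide_strict_left_mono) auto
        then show "0 < \<rho>" by (simp add: \<rho>_def)
        fix a b assume a: "a \<in> N s" and b: "b \<in> R (s + 1)"
        have "1 / (real s + 1) \<le> infdist a F" using a by (auto simp: N_def)
        moreover have "infdist b F < 1 / (real s + 2)"
          using b by (auto simp: R_def N_def not_le add.commute)
        moreover have "infdist a F \<le> infdist b F + dist a b" by (rule infdist_triangle)
        ultimately show "\<rho> \<le> dist a b" unfolding \<rho>_def by linarith
      qed
      also have "\<dots> \<le> ?H (N (2 * Suc m + c))"
        using Nmono[of s "s + 2"] by (intro hausdorff_measure_mono) (auto simp: R_def s_def)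
      finally show ?case .
    qed simp
    define f where "f k = ?H (R (k + 1))" for k
    have fsum: "(\<Sum>k<2 * m. f k) = (\<Sum>k<m. ?H (R (2 * k + 0 + 1))) + (\<Sum>k<m. ?H (R (2 * k + 1 + 1)))" for m
      by (induction m) (auto simp: f_def ac_simps)
    have "(\<Sum>k. f k) \<le> 2 * ?H A"
    proof (rule suminf_le_const[OF summableI])
      fix m
      have "(\<Sum>k<m. f k) \<le> (\<Sum>k<2 * m. f k)" by (rule sum_mono2) auto
      also have "\<dots> \<le> ?H A + ?H A"
        unfolding fsum
        by (intro add_mono order_trans[OF layers] hausdorff_measure_mono) (auto simp: N_def)
      finally show "(\<Sum>k<m. f k) \<le> 2 * ?H A" by (simp add: mult_2)
    qed
    also have "\<dots> < top" using False by (simp add: ennreal_mult_less_top less_top)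
    finally have fin: "(\<Sum>k. f k) < top" .
    \<comment> \<open>Adding the first \<open>n\<close> layers to both sides avoids subtraction; the limit \<open>n \<rightarrow> \<infinity>\<close> then cancels.\<close>
    have "?H (A \<inter> F) + ?H (A - F) + (\<Sum>k<n. f k) \<le> ?H A + (\<Sum>k. f k)" for n
    proof -
      have cover: "A - F \<subseteq> N (Suc n) \<union> (\<Union>k. R (k + n + 1))"
      proof
        fix x assume "x \<in> A - F"
        then have ex: "\<exists>m. x \<in> N m" using AF by auto
        define m where "m = (LEAST m. x \<in> N m)"
        have m: "x \<in> N m" and least: "\<And>l. l < m \<Longrightarrow> x \<notin> N l"
          using LeastI_ex[OF ex] not_less_Least unfolding m_def by auto
        show "x \<in> N (Suc n) \<union> (\<Union>k. R (k + n + 1))"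
        proof (cases "m \<le> Suc n")
          case True
          then show ?thesis using m Nmono by blast
        next
          case False
          then have "x \<in> R ((m - n - 2) + n + 1)"
            using m least[of "m - 1"] by (auto simp: R_def Suc_diff_Suc numeral_2_eq_2)
          then show ?thesis by blast
        qed
      qed
      have "?H (A - F) \<le> ?H (N (Suc n)) + ?H (\<Union>k. R (k + n + 1))"
        using hausdorff_measure_mono[OF cover] hausdorff_measure_Un_le order_trans by blast
      also have "\<dots> \<le> ?H (N (Suc n)) + (\<Sum>k. f (k + n))"
        unfolding f_def by (intro add_left_mono hausdorff_measure_countably_subadditive)
      finally have "?H (A \<inter> F) + ?H (A - F) + (\<Sum>k<n. f k)
          \<le> (?H (A \<inter> F) + ?H (N (Suc n))) + ((\<Sum>k. f (k + n)) + (\<Sum>k<n. f k))"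
        by (metis (no_types, lifting) add.assoc add_left_mono add_right_mono)
      also have "(\<Sum>k. f (k + n)) + (\<Sum>k<n. f k) = (\<Sum>k. f k)"
        by (rule suminf_offset[symmetric, OF summableI])
      also have "?H (A \<inter> F) + ?H (N (Suc n)) + (\<Sum>k. f k) \<le> ?H A + (\<Sum>k. f k)"
        using ANF by (rule add_right_mono)
      finally show ?thesis .
    qed
    then have "?H (A \<inter> F) + ?H (A - F) + (\<Sum>k. f k) \<le> ?H A + (\<Sum>k. f k)"
      by (intro LIMSEQ_le_const2[OF tendsto_add[OF tendsto_const summable_LIMSEQ[OF summableI]]]) auto
    then show ?thesis
      using fin ennreal_add_left_cancel_le[of "\<Sum>k. f k"] by (auto simp: add.commute)
  qed simp
  then have "?H (A \<inter> F) + ?H (A - F) = ?H A" for A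
    using hausdorff_measure_Un_le[of p "A \<inter> F" "A - F"]
    by (metis Int_Diff_Un antisym)
  then show ?thesis
    unfolding hausdorff_measurable_def lambda_system_def
    by (auto simp: Int_commute Diff_eq)
qed

text \<open>
  By Lindeloef, countably many of the pieces cover \<open>E\<close>. They are compact, so \<open>E\<close> is a countable union
  of closed sets and hence measurable, and they leave no part of \<open>E\<close> uncovered.
\<close>

lemma rectifiable_if_locally_lipschitz_image:
  fixes E :: "'a::euclidean_space set"
  assumes local: "\<And>q. q \<in> E \<Longrightarrow> \<exists>U (K :: (real ^ 'p::finite) set) f.
    open U \<and> q \<in> U \<and> compact K \<and> (\<exists>C. C-lipschitz_on K f) \<and> E \<inter> U \<subseteq> f ` K \<and> f ` K \<subseteq> E"
  shows "rectifiable TYPE('p) E"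
proof -
  obtain U and K :: "'a \<Rightarrow> (real ^ 'p) set" and f where
    U: "\<And>q. q \<in> E \<Longrightarrow> open (U q)" "\<And>q. q \<in> E \<Longrightarrow> q \<in> U q" and
    K: "\<And>q. q \<in> E \<Longrightarrow> compact (K q)" "\<And>q. q \<in> E \<Longrightarrow> \<exists>C. C-lipschitz_on (K q) (f q)" and
    img: "\<And>q. q \<in> E \<Longrightarrow> E \<inter> U q \<subseteq> f q ` K q" "\<And>q. q \<in> E \<Longrightarrow> f q ` K q \<subseteq> E"
  proof -
    define R where "R q U K f \<longleftrightarrow> open U \<and> q \<in> U \<and> compact K \<and>
        (\<exists>C. C-lipschitz_on K f) \<and> E \<inter> U \<subseteq> f ` K \<and> f ` K \<subseteq> E"
      for q U and K :: "(real ^ 'p) set" and f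
    have "\<forall>q\<in>E. \<exists>U K f. R q U K f" using local unfolding R_def by blast
    then obtain U where "\<forall>q\<in>E. \<exists>K f. R q (U q) K f" by (rule bchoice[THEN exE])
    then obtain K where "\<forall>q\<in>E. \<exists>f. R q (U q) (K q) f" by (rule bchoice[THEN exE])
    then obtain f where "\<forall>q\<in>E. R q (U q) (K q) (f q)" by (rule bchoice[THEN exE])
    then show ?thesis using that[of U K f] unfolding R_def by simp
  qed
  obtain Q where Q: "Q \<subseteq> E" "countable Q" "(\<Union>q\<in>Q. U q) = (\<Union>q\<in>E. U q)"
  proof -
    obtain F where "F \<subseteq> U ` E" "countable F" "\<Union>F = (\<Union>q\<in>E. U q)"
      using Lindelof[of "U ` E"] U(1) by blast
    then show ?thesis using that by (metis countable_subset_image)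
  qed
  \<comment> \<open>For empty \<open>Q\<close> the points \<open>q n\<close> are arbitrary, so the pieces have to be empty by definition.\<close>
  define q where "q n = from_nat_into Q n" for n
  define K' where "K' n = (if Q = {} then {} else K (q n))" for n
  define f' where "f' n = f (q n)" for n
  have qE: "q n \<in> E" if "Q \<noteq> {}" for n
    using from_nat_into[OF that] Q(1) by (auto simp: q_def)
  have K': "compact (K' n)" "\<exists>C. C-lipschitz_on (K' n) (f' n)" for n
    using K[OF qE] by (auto simp: K'_def f'_def)
  have E: "E = (\<Union>n. f' n ` K' n)"
  proof
    show "(\<Union>n. f' n ` K' n) \<subseteq> E"
      using img(2)[OF qE] by (auto simp: K'_def f'_def image_subset_iff split: if_splits)
    show "E \<subseteq> (\<Union>n. f' n ` K' n)"
    proof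
      fix x assume x: "x \<in> E"
      then obtain a where a: "a \<in> Q" "x \<in> U a" using U(2) Q(3) by blast
      then obtain n where "q n = a"
        using from_nat_into_surj[OF Q(2)] by (auto simp: q_def)
      with a x have "x \<in> f' n ` K' n" using img(1)[of a] Q(1) by (auto simp: K'_def f'_def)
      then show "x \<in> (\<Union>n. f' n ` K' n)" by blast
    qed
  qed
  interpret sigma_algebra UNIV "{E :: 'a set. hausdorff_measurable CARD('p) E}"
    by (rule sigma_algebra_hausdorff_measurable)
  have "closed (f' n ` K' n)" for n
    using K'[of n] by (metis compact_continuous_image compact_imp_closed lipschitz_on_continuous_on)
  then have "(\<Union>n. f' n ` K' n) \<in> {E. hausdorff_measurable CARD('p) E}"
    by (intro countable_UN) (auto intro: hausdorff_measurable_closed)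
  then have "hausdorff_measurable CARD('p) E" using E by simp
  moreover have "hausdorff_measure CARD('p) (E - (\<Union>n. f' n ` K' n)) = 0"
    using E by simp
  ultimately show ?thesis
    unfolding rectifiable_def using K' by blast
qed

section \<open>Calculus of maps of class \<open>C\<^sup>1\<close>\<close>

lemma C1_onD:
  assumes "Cr_on 1 U f"
  shows "x \<in> U \<Longrightarrow> (f has_derivative frechet_derivative f (at x)) (at x)"
    and "continuous_on U (\<lambda>x. frechet_derivative f (at x) v)"
  using assms by (auto simp: frechet_derivative_works)

lemma C1_onI:
  assumes "\<And>x. x \<in> U \<Longrightarrow> (f has_derivative f' x) (at x)"
    and "\<And>v. continuous_on U (\<lambda>x. f' x v)"
  shows "Cr_on 1 U f"
proof -
  have "frechet_derivative f (at x) = f' x" if "x \<in> U" for x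
    using frechet_derivative_at[OF assms(1)[OF that]] by simp
  then have "continuous_on U (\<lambda>x. frechet_derivative f (at x) v)" for v
    using assms(2)[of v] by (simp cong: continuous_on_cong)
  then show ?thesis
    using assms(1) by (auto simp: differentiable_def)
qed

lemma C1_on_imp_continuous_on: "Cr_on 1 U f \<Longrightarrow> continuous_on U f"
  by (meson C1_onD(1) continuous_at_imp_continuous_on has_derivative_continuous)

lemma C1_on_subset: "Cr_on 1 U f \<Longrightarrow> N \<subseteq> U \<Longrightarrow> Cr_on 1 N f"
  by (auto intro: continuous_on_subset)

lemma C2_on_derivative: "Cr_on 2 U f \<Longrightarrow> Cr_on 1 U (\<lambda>x. frechet_derivative f (at x) v)"
  by (auto simp: numeral_2_eq_2)

lemma C2_on_imp_C1_on:
  assumes "Cr_on 2 U f"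
  shows "Cr_on 1 U f"
  using assms C1_on_imp_continuous_on[OF C2_on_derivative[OF assms]]
  by (simp add: numeral_2_eq_2)

text \<open>
  The simplifier would otherwise unfold \<open>Cr_on 1\<close> and bypass the closure rules below.
\<close>

declare Cr_on.simps(2) [simp del]

lemma linear_derivative: "Cr_on 1 U f \<Longrightarrow> x \<in> U \<Longrightarrow> linear (frechet_derivative f (at x))"
  by (rule has_derivative_linear[OF C1_onD(1)])

lemma C1_on_cong:
  assumes "open U" "\<And>x. x \<in> U \<Longrightarrow> f x = g x" "Cr_on 1 U f"
  shows "Cr_on 1 U g"
proof (rule C1_onI)
  show "(g has_derivative frechet_derivative f (at x)) (at x)" if "x \<in> U" for x
    using C1_onD(1)[OF assms(3) that] assms(1) that assms(2)
    by (rule has_derivative_transform_within_open)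
qed (rule C1_onD(2)[OF assms(3)])

lemma C1_on_const: "Cr_on 1 U (\<lambda>x. c)"
  by (rule C1_onI[where f' = "\<lambda>x v. 0"]) auto

lemma C1_on_diff:
  assumes f: "Cr_on 1 U f" and g: "Cr_on 1 U g"
  shows "Cr_on 1 U (\<lambda>x. f x - g x)"
  by (rule C1_onI[OF has_derivative_diff[OF C1_onD(1)[OF f] C1_onD(1)[OF g]]])
     (assumption | intro continuous_on_diff C1_onD(2)[OF f] C1_onD(2)[OF g])+

lemma C1_on_sum:
  assumes f: "\<And>i. i \<in> I \<Longrightarrow> Cr_on 1 U (f i)"
  shows "Cr_on 1 U (\<lambda>x. \<Sum>i\<in>I. f i x)"
  by (rule C1_onI[OF has_derivative_sum[OF C1_onD(1)[OF f]]])
     (assumption | intro continuous_on_sum C1_onD(2)[OF f])+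

lemma C1_on_bilinear:
  assumes B: "bounded_bilinear B" and f: "Cr_on 1 U f" and g: "Cr_on 1 U g"
  shows "Cr_on 1 U (\<lambda>x. B (f x) (g x))"
  by (rule C1_onI[OF bounded_bilinear.FDERIV[OF B C1_onD(1)[OF f] C1_onD(1)[OF g]]])
     (assumption | intro continuous_on_add bounded_bilinear.continuous_on[OF B]
       C1_on_imp_continuous_on f g C1_onD(2)[OF f] C1_onD(2)[OF g])+

lemmas C1_on_scaleR = C1_on_bilinear[OF bounded_bilinear_scaleR]
lemmas C1_on_inner = C1_on_bilinear[OF bounded_bilinear_inner]

text \<open>
  The identity turns separate continuity or differentiability of \<open>x \<mapsto> P x b\<close> for constant \<open>b\<close> into
  the corresponding joint statements about \<open>x \<mapsto> P x (Z x)\<close>, because both factors of each summand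
  depend on \<open>x\<close> only.
\<close>

lemma linear_expansion:
  fixes f :: "'a::euclidean_space \<Rightarrow> 'b::real_vector"
  assumes "linear f"
  shows "f z = (\<Sum>b\<in>Basis. (z \<bullet> b) *\<^sub>R f b)"
proof -
  have "f z = f (\<Sum>b\<in>Basis. (z \<bullet> b) *\<^sub>R b)" by (simp add: euclidean_representation)
  then show ?thesis by (simp add: linear_sum[OF assms] linear_cmul[OF assms])
qed

lemma C1_on_compose:
  assumes f: "Cr_on 1 U f" and g: "Cr_on 1 V g" and fU: "f ` U \<subseteq> V"
  shows "Cr_on 1 U (\<lambda>x. g (f x))"
proof (rule C1_onI)
  let ?g' = "\<lambda>x. frechet_derivative g (at (f x))"
  show "((\<lambda>x. g (f x)) has_derivative
      (\<lambda>v. ?g' x (frechet_derivative f (at x) v))) (at x)" if "x \<in> U" for x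
    by (rule has_derivative_compose[OF C1_onD(1)[OF f that] C1_onD(1)[OF g]]) (use fU that in auto)
  show "continuous_on U (\<lambda>x. ?g' x (frechet_derivative f (at x) v))" for v
  proof -
    have "continuous_on U (\<lambda>x. ?g' x b)" for b
      by (rule continuous_on_compose2[OF C1_onD(2)[OF g] C1_on_imp_continuous_on[OF f] fU])
    then have cont: "continuous_on U
        (\<lambda>x. \<Sum>b\<in>Basis. (frechet_derivative f (at x) v \<bullet> b) *\<^sub>R ?g' x b)"
      by (intro continuous_intros C1_onD(2)[OF f])
    have lin: "linear (?g' x)" if "x \<in> U" for x
      using C1_onD(1)[OF g] fU that by (intro has_derivative_linear) blast
    show ?thesis
      by (rule continuous_on_eq[OF cont]) (rule linear_expansion[OF lin, symmetric])
  qed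
qed

lemma C1_on_linear_field:
  fixes P :: "'a::euclidean_space \<Rightarrow> 'b::euclidean_space \<Rightarrow> 'c::euclidean_space"
  assumes U: "open U" and lin: "\<And>x. x \<in> U \<Longrightarrow> linear (P x)"
    and P: "\<And>z. Cr_on 1 U (\<lambda>x. P x z)" and Z: "Cr_on 1 U Z"
  shows "Cr_on 1 U (\<lambda>x. P x (Z x))"
proof (rule C1_on_cong[OF U])
  show "(\<Sum>b\<in>Basis. (Z x \<bullet> b) *\<^sub>R P x b) = P x (Z x)" if "x \<in> U" for x
    by (rule linear_expansion[OF lin[OF that], symmetric])
  show "Cr_on 1 U (\<lambda>x. \<Sum>b\<in>Basis. (Z x \<bullet> b) *\<^sub>R P x b)"
    by (intro C1_on_sum C1_on_scaleR C1_on_inner Z C1_on_const P)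
qed

lemma linear_derivative_of_linear_field:
  fixes P :: "'a::euclidean_space \<Rightarrow> 'b::euclidean_space \<Rightarrow> 'c::euclidean_space"
  assumes U: "open U" "q \<in> U" and lin: "\<And>x. x \<in> U \<Longrightarrow> linear (P x)"
    and P': "\<And>z. ((\<lambda>x. P x z) has_derivative (\<lambda>v. P' v z)) (at q)"
  shows "linear (P' v)"
proof -
  have exp: "P' v z = (\<Sum>b\<in>Basis. (z \<bullet> b) *\<^sub>R P' v b)" for v z
  proof -
    have "((\<lambda>x. \<Sum>b\<in>Basis. (z \<bullet> b) *\<^sub>R P x b) has_derivative
        (\<lambda>v. \<Sum>b\<in>Basis. (z \<bullet> b) *\<^sub>R P' v b)) (at q)"
      by (intro has_derivative_sum has_derivative_scaleR_right P')
    then have "((\<lambda>x. P x z) has_derivative (\<lambda>v. \<Sum>b\<in>Basis. (z \<bullet> b) *\<^sub>R P' v b)) (at q)"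
      by (rule has_derivative_transform_within_open[OF _ U]) (rule linear_expansion[OF lin, symmetric])
    from has_derivative_unique[OF P' this] show ?thesis by metis
  qed
  define c where "c b = P' v b" for b
  have "P' v = (\<lambda>z. \<Sum>b\<in>Basis. (z \<bullet> b) *\<^sub>R c b)"
    unfolding c_def by (rule ext) (rule exp)
  then show ?thesis
    by (auto intro!: linearI simp: inner_add_left scaleR_add_left sum.distrib scaleR_sum_right)
qed

lemma has_derivative_linear_field:
  fixes P :: "'a::euclidean_space \<Rightarrow> 'b::euclidean_space \<Rightarrow> 'c::euclidean_space"
  assumes U: "open U" "q \<in> U" and lin: "\<And>x. x \<in> U \<Longrightarrow> linear (P x)"
    and P': "\<And>z. ((\<lambda>x. P x z) has_derivative (\<lambda>v. P' v z)) (at q)"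
    and Z: "(Z has_derivative Z') (at q)"
  shows "((\<lambda>x. P x (Z x)) has_derivative (\<lambda>v. P' v (Z q) + P q (Z' v))) (at q)"
proof -
  have *: "((\<lambda>x. \<Sum>b\<in>Basis. (Z x \<bullet> b) *\<^sub>R P x b) has_derivative
      (\<lambda>v. \<Sum>b\<in>Basis. (Z q \<bullet> b) *\<^sub>R P' v b + (Z' v \<bullet> b) *\<^sub>R P q b)) (at q)"
    by (intro has_derivative_sum has_derivative_scaleR P' has_derivative_inner_left Z)
  have linP': "linear (P' v)" for v
    by (rule linear_derivative_of_linear_field[OF U lin P'])
  then have "(\<lambda>v. \<Sum>b\<in>Basis. (Z q \<bullet> b) *\<^sub>R P' v b + (Z' v \<bullet> b) *\<^sub>R P q b)
      = (\<lambda>v. P' v (Z q) + P q (Z' v))"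
    using linear_expansion[OF lin[OF U(2)], symmetric] linear_expansion[OF linP', symmetric]
    by (simp add: sum.distrib fun_eq_iff)
  with * have "((\<lambda>x. \<Sum>b\<in>Basis. (Z x \<bullet> b) *\<^sub>R P x b) has_derivative
      (\<lambda>v. P' v (Z q) + P q (Z' v))) (at q)" by simp
  then show ?thesis
    by (rule has_derivative_transform_within_open[OF _ U])
       (simp add: linear_expansion[OF lin, symmetric])
qed

text \<open>
  Continuity of the partial derivatives makes \<open>Df\<close> continuous in operator norm, and the mean value
  inequality on a small ball compares \<open>f\<close> with its linearization at the centre.
\<close>

lemma C1_on_strict_derivative:
  fixes f :: "'a::euclidean_space \<Rightarrow> 'b::euclidean_space"
  assumes U: "open U" "q \<in> U" and f: "Cr_on 1 U f" and e: "0 < e"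
  shows "\<exists>r>0. cball q r \<subseteq> U \<and> (\<forall>y\<in>cball q r. \<forall>z\<in>cball q r.
    norm (f y - f z - frechet_derivative f (at q) (y - z)) \<le> e * norm (y - z))"
proof -
  let ?f' = "\<lambda>x. frechet_derivative f (at x)"
  define d where "d = e / DIM('a)"
  have d: "0 < d" using e by (simp add: d_def)
  have "\<forall>\<^sub>F x in nhds q. x \<in> U \<and> (\<forall>b\<in>Basis. dist (?f' x b) (?f' q b) < d)"
  proof (intro eventually_conj eventually_ball_finite ballI)
    show "\<forall>\<^sub>F x in nhds q. x \<in> U" using U by (rule eventually_nhds_in_open)
    show "\<forall>\<^sub>F x in nhds q. dist (?f' x b) (?f' q b) < d" for b
    proof -
      have "isCont (\<lambda>x. ?f' x b) q"
        using C1_onD(2)[OF f, of b] U by (simp add: continuous_on_eq_continuous_at)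
      then have "((\<lambda>x. ?f' x b) \<longlongrightarrow> ?f' q b) (nhds q)"
        by (metis (no_types) isCont_def tendsto_at_iff_tendsto_nhds)
      then show ?thesis using d by (rule tendstoD)
    qed
  qed simp
  then obtain s where s: "0 < s"
    "\<And>x. dist x q < s \<Longrightarrow> x \<in> U \<and> (\<forall>b\<in>Basis. dist (?f' x b) (?f' q b) < d)"
    unfolding eventually_nhds_metric by blast
  define r where "r = s / 2"
  have r: "0 < r" "r < s" using s(1) by (auto simp: r_def)
  have near: "x \<in> U" "\<And>b. b \<in> Basis \<Longrightarrow> norm (?f' x b - ?f' q b) \<le> d" if "x \<in> cball q r" for x
    using s(2)[of x] that r by (auto simp: dist_commute dist_norm norm_minus_commute less_imp_le)
  have lin: "linear (?f' x)" if "x \<in> U" for x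
    using C1_onD(1)[OF f that] by (rule has_derivative_linear)
  have on: "onorm (?f' x - ?f' q) \<le> e" if x: "x \<in> cball q r" for x
  proof (rule onorm_le)
    fix w
    have "linear (?f' x - ?f' q)"
      unfolding fun_diff_def by (intro linear_compose_sub lin near(1) x U)
    from linear_expansion[OF this, of w]
    have "norm ((?f' x - ?f' q) w) \<le> (\<Sum>b\<in>Basis. norm ((w \<bullet> b) *\<^sub>R (?f' x - ?f' q) b))"
      by (metis norm_sum)
    also have "\<dots> \<le> (\<Sum>b\<in>(Basis::'a set). norm w * d)"
      using near(2)[OF x] by (intro sum_mono) (auto intro!: mult_mono Basis_le_norm)
    also have "\<dots> = e * norm w" by (simp add: d_def)
    finally show "norm ((?f' x - ?f' q) w) \<le> e * norm w" .
  qed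
  have "norm (f y - f z - ?f' q (y - z)) \<le> norm (y - z) * e"
    if "y \<in> cball q r" "z \<in> cball q r" for y z
  proof (rule differentiable_bound_linearization[where S = "cball q r"])
    show "z + t *\<^sub>R (y - z) \<in> cball q r" if "t \<in> {0..1}" for t
    proof -
      have "(1 - t) *\<^sub>R z + t *\<^sub>R y \<in> cball q r"
        using convex_cball[of q r] \<open>y \<in> _\<close> \<open>z \<in> _\<close> that unfolding convex_alt by auto
      then show ?thesis by (simp add: algebra_simps)
    qed
    show "(f has_derivative ?f' x) (at x within cball q r)" if "x \<in> cball q r" for x
      using C1_onD(1)[OF f near(1)[OF that]] by (rule has_derivative_at_withinI)
    show "onorm (?f' x - ?f' q) \<le> e" if "x \<in> cball q r" for x by (rule on[OF that])
  qed (use r in auto)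
  then show ?thesis
    using r near(1) by (intro exI[of _ r]) (auto simp: mult.commute)
qed

text \<open>
  The second difference \<open>\<Delta> u v t\<close> is symmetric in \<open>u\<close> and \<open>v\<close>. Seen as the increment over \<open>s \<in> [0, t]\<close>
  of \<open>f (q + s u + t v) - f (q + s u)\<close>, whose derivative is approximately \<open>t D2 v u\<close> by strict
  differentiability of the map \<open>y \<mapsto> Df(y) u\<close>, it equals \<open>t\<^sup>2 D2 v u\<close> up to an error of order
  \<open>\<epsilon> t\<^sup>2\<close>.
\<close>

lemma symmetric_second_derivative:
  fixes f :: "'a::euclidean_space \<Rightarrow> 'b::euclidean_space"
  assumes U: "open U" "q \<in> U" and f: "Cr_on 2 U f"
  defines "D2 \<equiv> \<lambda>u v. frechet_derivative (\<lambda>y. frechet_derivative f (at y) v) (at q) u"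
  shows "D2 u v = D2 v u"
proof -
  let ?f' = "\<lambda>x. frechet_derivative f (at x)"
  note f1 = C2_on_imp_C1_on[OF f]
  note g1 = C2_on_derivative[OF f]
  have lin2: "linear (\<lambda>u. D2 u v)" for v
    unfolding D2_def using C1_onD(1)[OF g1 U(2)] by (rule has_derivative_linear)
  have linf: "linear (?f' x)" if "x \<in> U" for x
    using C1_onD(1)[OF f1 that] by (rule has_derivative_linear)
  define \<Delta> where "\<Delta> u v t = f (q + t *\<^sub>R u + t *\<^sub>R v) - f (q + t *\<^sub>R u) - f (q + t *\<^sub>R v) + f q" for u v t
  have est: "\<exists>t0>0. \<forall>t. 0 < t \<and> t < t0 \<longrightarrow> norm (\<Delta> u v t - t\<^sup>2 *\<^sub>R D2 v u) \<le> e * t\<^sup>2 * norm v"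
    if e: "0 < e" for u v e
  proof -
    obtain r where r: "0 < r" "cball q r \<subseteq> U" and
      str: "\<And>y z. y \<in> cball q r \<Longrightarrow> z \<in> cball q r \<Longrightarrow>
        norm (?f' y u - ?f' z u - D2 (y - z) u) \<le> e * norm (y - z)"
      using C1_on_strict_derivative[OF U g1 e, of u] unfolding D2_def by blast
    define t0 where "t0 = r / (norm u + norm v + 1)"
    have nz: "0 < norm u + norm v + 1" by (smt (verit) norm_ge_zero)
    have "norm (\<Delta> u v t - t\<^sup>2 *\<^sub>R D2 v u) \<le> e * t\<^sup>2 * norm v" if t: "0 < t" "t < t0" for t
    proof -
      have tr: "t * norm u + t * norm v \<le> r"
      proof -
        have "t * (norm u + norm v + 1) \<le> r"
          using t(2) nz by (simp add: t0_def field_simps less_imp_le)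
        then show ?thesis using t(1) by (simp add: distrib_left)
      qed
      have in1: "q + s *\<^sub>R u + t *\<^sub>R v \<in> cball q r" and in2: "q + s *\<^sub>R u \<in> cball q r"
        if "s \<in> {0..t}" for s
      proof -
        have su: "norm (s *\<^sub>R u) \<le> t * norm u"
          using that by (simp add: mult_right_mono)
        have tv: "norm (t *\<^sub>R v) = t * norm v" using t by simp
        have "norm (s *\<^sub>R u + t *\<^sub>R v) \<le> r"
          using norm_triangle_ineq[of "s *\<^sub>R u" "t *\<^sub>R v"] su tv tr by linarith
        moreover have "dist q (q + w) = norm w" for w by (simp add: dist_norm)
        ultimately show "q + s *\<^sub>R u + t *\<^sub>R v \<in> cball q r" by (simp add: add.assoc)
        have "0 \<le> t * norm v" using t by simp
        then show "q + s *\<^sub>R u \<in> cball q r"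
          using su tr by (simp add: dist_norm) 
      qed
      define \<phi> where "\<phi> s = f (q + s *\<^sub>R u + t *\<^sub>R v) - f (q + s *\<^sub>R u) - (s * t) *\<^sub>R D2 v u" for s
      define \<phi>' where "\<phi>' s = ?f' (q + s *\<^sub>R u + t *\<^sub>R v) u - ?f' (q + s *\<^sub>R u) u - t *\<^sub>R D2 v u" for s
      have d\<phi>: "(\<phi> has_derivative (\<lambda>h. h *\<^sub>R \<phi>' s)) (at s within {0..t})" if s: "s \<in> {0..t}" for s
      proof -
        have a: "q + s *\<^sub>R u + t *\<^sub>R v \<in> U" "q + s *\<^sub>R u \<in> U" using in1[OF s] in2[OF s] r by auto
        have "((\<lambda>s. f (q + s *\<^sub>R u + t *\<^sub>R v)) has_derivative (\<lambda>h. ?f' (q + s *\<^sub>R u + t *\<^sub>R v) (h *\<^sub>R u))) (at s)"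
          by (rule has_derivative_compose[where f = "\<lambda>s. q + s *\<^sub>R u + t *\<^sub>R v", OF _ C1_onD(1)[OF f1 a(1)]]) (auto intro!: derivative_eq_intros)
        moreover have "((\<lambda>s. f (q + s *\<^sub>R u)) has_derivative (\<lambda>h. ?f' (q + s *\<^sub>R u) (h *\<^sub>R u))) (at s)"
          by (rule has_derivative_compose[where f = "\<lambda>s. q + s *\<^sub>R u", OF _ C1_onD(1)[OF f1 a(2)]]) (auto intro!: derivative_eq_intros)
        moreover have "((\<lambda>s. (s * t) *\<^sub>R D2 v u) has_derivative (\<lambda>h. (h * t) *\<^sub>R D2 v u)) (at s)"
          by (auto intro!: derivative_eq_intros)
        ultimately have "(\<phi> has_derivative (\<lambda>h. ?f' (q + s *\<^sub>R u + t *\<^sub>R v) (h *\<^sub>R u)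
            - ?f' (q + s *\<^sub>R u) (h *\<^sub>R u) - (h * t) *\<^sub>R D2 v u)) (at s)"
          unfolding \<phi>_def by (intro has_derivative_diff)
        moreover have "(\<lambda>h. ?f' (q + s *\<^sub>R u + t *\<^sub>R v) (h *\<^sub>R u)
            - ?f' (q + s *\<^sub>R u) (h *\<^sub>R u) - (h * t) *\<^sub>R D2 v u) = (\<lambda>h. h *\<^sub>R \<phi>' s)"
          using linf[OF a(1)] linf[OF a(2)]
          by (auto simp: \<phi>'_def linear_cmul scaleR_diff_right)
        ultimately show ?thesis by (simp add: has_derivative_at_withinI)
      qed
      have b\<phi>: "norm (\<phi>' s) \<le> e * t * norm v" if s: "s \<in> {0..t}" for s
      proof -
        have "\<phi>' s = ?f' (q + s *\<^sub>R u + t *\<^sub>R v) u - ?f' (q + s *\<^sub>R u) u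
            - D2 ((q + s *\<^sub>R u + t *\<^sub>R v) - (q + s *\<^sub>R u)) u"
          using linear_cmul[OF lin2, of t v u] by (simp add: \<phi>'_def)
        then have "norm (\<phi>' s) \<le> e * norm ((q + s *\<^sub>R u + t *\<^sub>R v) - (q + s *\<^sub>R u))"
          using str[OF in1[OF s] in2[OF s]] by simp
        then show ?thesis using t by simp
      qed
      have "norm (\<phi> t - \<phi> 0) \<le> (e * t * norm v) * norm (t - 0)"
      proof (rule differentiable_bound[OF _ d\<phi>])
        show "onorm (\<lambda>h. h *\<^sub>R \<phi>' s) \<le> e * t * norm v" if "s \<in> {0..t}" for s
          using b\<phi>[OF that] by (intro onorm_le) (simp add: mult.commute mult_left_mono)
      qed (use t in auto)
      moreover have "\<phi> t - \<phi> 0 = \<Delta> u v t - t\<^sup>2 *\<^sub>R D2 v u"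
        by (simp add: \<phi>_def \<Delta>_def power2_eq_square algebra_simps)
      ultimately show ?thesis using t by (simp add: power2_eq_square ac_simps)
    qed
    moreover have "0 < t0" using r(1) nz by (simp add: t0_def)
    ultimately show ?thesis by blast
  qed
  have "norm (D2 u v - D2 v u) \<le> e * (norm u + norm v)" if e: "0 < e" for e
  proof -
    obtain t1 t2 where t12: "0 < t1" "0 < t2"
      "\<And>t. 0 < t \<Longrightarrow> t < t1 \<Longrightarrow> norm (\<Delta> u v t - t\<^sup>2 *\<^sub>R D2 v u) \<le> e * t\<^sup>2 * norm v"
      "\<And>t. 0 < t \<Longrightarrow> t < t2 \<Longrightarrow> norm (\<Delta> v u t - t\<^sup>2 *\<^sub>R D2 u v) \<le> e * t\<^sup>2 * norm u"
      using est[OF e, of u v] est[OF e, of v u] by blast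
    define t where "t = min t1 t2 / 2"
    have t: "0 < t" "t < t1" "t < t2" using t12(1,2) by (auto simp: t_def)
    have "\<Delta> u v t = \<Delta> v u t" by (simp add: \<Delta>_def algebra_simps)
    then have "t\<^sup>2 *\<^sub>R (D2 u v - D2 v u)
        = (\<Delta> u v t - t\<^sup>2 *\<^sub>R D2 v u) - (\<Delta> v u t - t\<^sup>2 *\<^sub>R D2 u v)"
      by (simp add: scaleR_diff_right)
    then have "norm (t\<^sup>2 *\<^sub>R (D2 u v - D2 v u)) \<le> e * t\<^sup>2 * norm v + e * t\<^sup>2 * norm u"
      using t12(3)[OF t(1,2)] t12(4)[OF t(1,3)]
        norm_triangle_ineq4[of "\<Delta> u v t - t\<^sup>2 *\<^sub>R D2 v u" "\<Delta> v u t - t\<^sup>2 *\<^sub>R D2 u v"] by simp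
    also have "\<dots> = t\<^sup>2 * (e * (norm u + norm v))" by (simp add: algebra_simps)
    finally show ?thesis using t(1) by simp
  qed
  note bound = this
  have "norm (D2 u v - D2 v u) \<le> 0"
  proof (rule field_le_epsilon)
    fix e :: real assume e: "0 < e"
    have nz: "0 < norm u + norm v + 1" by (smt (verit) norm_ge_zero)
    have "norm (D2 u v - D2 v u) \<le> e / (norm u + norm v + 1) * (norm u + norm v)"
      using bound[of "e / (norm u + norm v + 1)"] e nz by simp
    also have "\<dots> \<le> 0 + e" using e nz by (simp add: field_simps)
    finally show "norm (D2 u v - D2 v u) \<le> 0 + e" .
  qed
  then show ?thesis by simp
qed

section \<open>Projections onto a distribution and the tensoriality of the bracket\<close>

lemma distribution_on_subset:
  "distribution_on 1 U k V \<Longrightarrow> N \<subseteq> U \<Longrightarrow> distribution_on 1 N k V"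
  unfolding distribution_on_def using C1_on_subset by blast

text \<open>
  Gram-Schmidt: each step uses only sums, inner products and the function \<open>s \<mapsto> 1 / sqrt s\<close> on positive
  numbers, all of which preserve the class \<open>C\<^sup>1\<close>. The dimension assumption keeps the new direction
  outside the span of the previous ones, hence nonzero.
\<close>

lemma orthonormal_frame_C1:
  fixes X :: "nat \<Rightarrow> 'a::euclidean_space \<Rightarrow> 'a"
  assumes U: "open U"
  shows "(\<forall>i\<in>{1..k}. Cr_on 1 U (X i)) \<Longrightarrow> (\<forall>x\<in>U. dim ((\<lambda>i. X i x) ` {1..k}) = k) \<Longrightarrow>
    \<exists>e :: nat \<Rightarrow> 'a \<Rightarrow> 'a. (\<forall>i\<in>{1..k}. Cr_on 1 U (e i)) \<and>
      (\<forall>x\<in>U. (\<forall>i\<in>{1..k}. \<forall>j\<in>{1..k}. e i x \<bullet> e j x = (if i = j then 1 else 0)) \<and>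
        span ((\<lambda>i. e i x) ` {1..k}) = span ((\<lambda>i. X i x) ` {1..k}))"
proof (induction k)
  case 0
  then show ?case by simp
next
  case (Suc k)
  have step: "(\<lambda>i. Y i x) ` {1..Suc k} = insert (Y (Suc k) x) ((\<lambda>i. Y i x) ` {1..k})"
    for Y :: "nat \<Rightarrow> 'a \<Rightarrow> 'a" and x
    by (simp add: atLeastAtMostSuc_conv)
  have dims: "dim ((\<lambda>i. X i x) ` {1..k}) = k \<and> X (Suc k) x \<notin> span ((\<lambda>i. X i x) ` {1..k})"
    if "x \<in> U" for x
  proof -
    let ?A = "(\<lambda>i. X i x) ` {1..k}"
    have "dim ?A \<le> card ?A" by (rule dim_le_card') simp
    also have "\<dots> \<le> k" using card_image_le[of "{1..k}" "\<lambda>i. X i x"] by simp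
    finally have "dim ?A \<le> k" .
    moreover have "dim (insert (X (Suc k) x) ?A) = Suc k"
      using Suc.prems(2) that step[of X x] by metis
    ultimately show ?thesis by (auto simp: dim_insert split: if_splits)
  qed
  have prems: "\<forall>i\<in>{1..k}. Cr_on 1 U (X i)" "\<forall>x\<in>U. dim ((\<lambda>i. X i x) ` {1..k}) = k"
    using Suc.prems(1) dims by auto
  obtain e where e: "\<forall>i\<in>{1..k}. Cr_on 1 U (e i)"
    and frame: "\<forall>x\<in>U. (\<forall>i\<in>{1..k}. \<forall>j\<in>{1..k}. e i x \<bullet> e j x = (if i = j then 1 else 0)) \<and>
        span ((\<lambda>i. e i x) ` {1..k}) = span ((\<lambda>i. X i x) ` {1..k})"
    using Suc.IH[OF prems] by (elim exE conjE)
  have orth: "\<And>x i j. x \<in> U \<Longrightarrow> i \<in> {1..k} \<Longrightarrow> j \<in> {1..k} \<Longrightarrow> e i x \<bullet> e j x = (if i = j then 1 else 0)"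
    and sp: "\<And>x. x \<in> U \<Longrightarrow> span ((\<lambda>i. e i x) ` {1..k}) = span ((\<lambda>i. X i x) ` {1..k})"
    using frame by (simp_all del: atLeastAtMost_iff)
  define Y where "Y x = (\<Sum>i\<in>{1..k}. (X (Suc k) x \<bullet> e i x) *\<^sub>R e i x)" for x
  define u where "u x = X (Suc k) x - Y x" for x
  define e' where "e' x = (1 / sqrt (u x \<bullet> u x)) *\<^sub>R u x" for x
  have Yspan: "Y x \<in> span ((\<lambda>i. e i x) ` {1..k})" for x
    unfolding Y_def by (intro span_sum span_scale span_base) auto
  have u0: "u x \<noteq> 0" if "x \<in> U" for x
    using Yspan[of x] dims[OF that] sp[OF that] by (auto simp: u_def)
  have uC1: "Cr_on 1 U u"
  proof -
    have "Cr_on 1 U (X (Suc k))" using Suc.prems(1) by simp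
    then show ?thesis
      unfolding u_def Y_def using e
      by (intro C1_on_diff C1_on_sum C1_on_scaleR C1_on_inner) auto
  qed
  have e'C1: "Cr_on 1 U e'"
  proof -
    have *: "Cr_on 1 {0<..} (\<lambda>s::real. 1 / sqrt s)"
    proof (rule C1_onI)
      show "((\<lambda>s. 1 / sqrt s) has_derivative (\<lambda>v. - (inverse (sqrt s) / 2) / (sqrt s * sqrt s) * v)) (at s)"
        if "s \<in> {0<..}" for s :: real
        using that by (auto intro!: derivative_eq_intros simp: field_simps)
      show "continuous_on {0<..} (\<lambda>s. - (inverse (sqrt s) / 2) / (sqrt s * sqrt s) * v)" for v :: real
        by (intro continuous_intros) auto
    qed
    have "Cr_on 1 U (\<lambda>x. 1 / sqrt (u x \<bullet> u x))"
      by (rule C1_on_compose[OF C1_on_inner[OF uC1 uC1] *]) (use u0 in auto)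
    then show ?thesis unfolding e'_def by (rule C1_on_scaleR[OF _ uC1])
  qed
  define E where "E i = (if i = Suc k then e' else e i)" for i
  have "\<forall>i\<in>{1..Suc k}. Cr_on 1 U (E i)" using e e'C1 by (auto simp: E_def)
  moreover have "E i x \<bullet> E j x = (if i = j then 1 else 0)"
    if x: "x \<in> U" and ij: "i \<in> {1..Suc k}" "j \<in> {1..Suc k}" for x i j
  proof -
    have ue: "u x \<bullet> e j x = 0" if "j \<in> {1..k}" for j
    proof -
      have "Y x \<bullet> e j x = (\<Sum>i\<in>{1..k}. (X (Suc k) x \<bullet> e i x) * (if i = j then 1 else 0))"
        unfolding Y_def inner_sum_left by (intro sum.cong) (use orth[OF x _ that] in auto)
      also have "\<dots> = X (Suc k) x \<bullet> e j x" using that by (simp add: if_distrib cong: if_cong)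
      finally show ?thesis by (simp add: u_def inner_diff_left)
    qed
    have "e' x \<bullet> e' x = 1"
      using u0[OF x] by (simp add: e'_def)
    moreover have "e' x \<bullet> e j x = 0" "e j x \<bullet> e' x = 0" if "j \<in> {1..k}" for j
      using ue[OF that] by (simp_all add: e'_def inner_commute)
    ultimately show ?thesis
      using orth[OF x, of i j] ij by (cases "i = Suc k"; cases "j = Suc k") (auto simp: E_def)
  qed
  moreover have "span ((\<lambda>i. E i x) ` {1..Suc k}) = span ((\<lambda>i. X i x) ` {1..Suc k})"
    if x: "x \<in> U" for x
  proof -
    have A: "(\<lambda>i. E i x) ` {1..Suc k} = insert (e' x) ((\<lambda>i. e i x) ` {1..k})"
      unfolding step by (auto simp: E_def)
    let ?A = "(\<lambda>i. e i x) ` {1..k}"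
    define c where "c = 1 / sqrt (u x \<bullet> u x)"
    have c: "c \<noteq> 0" using u0[OF x] by (simp add: c_def)
    have Xe: "X (Suc k) x = (1 / c) *\<^sub>R e' x + Y x"
      using c by (simp add: e'_def u_def c_def)
    have "X (Suc k) x \<in> span (insert (e' x) ?A)"
      unfolding Xe using Yspan[of x] span_mono[of ?A "insert (e' x) ?A"]
      by (intro span_add span_scale) (auto intro: span_base)
    moreover have "e' x \<in> span (insert (X (Suc k) x) ?A)"
      unfolding e'_def u_def using Yspan[of x] span_mono[of ?A "insert (X (Suc k) x) ?A"]
      by (intro span_scale span_diff) (auto intro: span_base)
    ultimately have 1: "span (insert (e' x) ?A) = span (insert (X (Suc k) x) ?A)"
      by (simp add: span_eq insert_subset) (meson span_superset subset_insertI subset_trans)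
    have "span (insert (X (Suc k) x) ?A) = span (insert (X (Suc k) x) ((\<lambda>i. X i x) ` {1..k}))"
      using sp[OF x] by (simp add: span_insert)
    with 1 show ?thesis unfolding A step by simp
  qed
  ultimately show ?case by blast
qed

text \<open>
  The orthogonal projection \<open>z \<mapsto> \<Sum>i. (z \<bullet> e i x) e i x\<close> is as regular in \<open>x\<close> as the orthonormal frame.
\<close>

lemma distribution_projection:
  fixes V :: "'a::euclidean_space \<Rightarrow> 'a set"
  assumes U: "open U" and V: "distribution_on 1 U k V"
  obtains P :: "'a \<Rightarrow> 'a \<Rightarrow> 'a" where
    "\<And>x. linear (P x)" "\<And>z. Cr_on 1 U (\<lambda>x. P x z)"
    "\<And>x z. x \<in> U \<Longrightarrow> P x z \<in> V x" "\<And>x z. x \<in> U \<Longrightarrow> z \<in> V x \<Longrightarrow> P x z = z"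
proof -
  obtain X where X: "\<forall>i\<in>{1..k}. Cr_on 1 U (X i)"
    and VX: "\<And>x. x \<in> U \<Longrightarrow> V x = span ((\<lambda>i. X i x) ` {1..k})" and dimV: "\<And>x. x \<in> U \<Longrightarrow> dim (V x) = k"
    using V unfolding distribution_on_def by blast
  have "\<forall>x\<in>U. dim ((\<lambda>i. X i x) ` {1..k}) = k"
    using VX dimV by (metis dim_span)
  from orthonormal_frame_C1[OF U X this] obtain e where e0: "\<forall>i\<in>{1..k}. Cr_on 1 U (e i)"
    and frame: "\<forall>x\<in>U. (\<forall>i\<in>{1..k}. \<forall>j\<in>{1..k}. e i x \<bullet> e j x = (if i = j then 1 else 0)) \<and>
        span ((\<lambda>i. e i x) ` {1..k}) = span ((\<lambda>i. X i x) ` {1..k})"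
    by (elim exE conjE)
  have e: "\<And>i. i \<in> {1..k} \<Longrightarrow> Cr_on 1 U (e i)"
    and orth: "\<And>x i j. x \<in> U \<Longrightarrow> i \<in> {1..k} \<Longrightarrow> j \<in> {1..k} \<Longrightarrow> e i x \<bullet> e j x = (if i = j then 1 else 0)"
    and Ve: "\<And>x. x \<in> U \<Longrightarrow> V x = span ((\<lambda>i. e i x) ` {1..k})"
    using e0 frame VX by (simp_all del: atLeastAtMost_iff)
  define P where "P x z = (\<Sum>i\<in>{1..k}. (z \<bullet> e i x) *\<^sub>R e i x)" for x z
  have lin: "linear (P x)" for x
    unfolding P_def
    by (intro linearI) (simp_all add: inner_add_left scaleR_add_left sum.distrib scaleR_sum_right)
  show thesis
  proof
    show "linear (P x)" for x by (rule lin)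
    show "Cr_on 1 U (\<lambda>x. P x z)" for z
      unfolding P_def by (intro C1_on_sum C1_on_scaleR C1_on_inner C1_on_const e)
    show "P x z \<in> V x" if "x \<in> U" for x z
      unfolding Ve[OF that] P_def by (intro span_sum span_scale span_base) auto
    show "P x z = z" if "x \<in> U" "z \<in> V x" for x z
    proof -
      have "P x z = id z"
      proof (rule linear_eq_on_span[OF lin linear_id])
        show "z \<in> span ((\<lambda>i. e i x) ` {1..k})" using that Ve by simp
        fix w assume "w \<in> (\<lambda>i. e i x) ` {1..k}"
        then obtain j where j: "j \<in> {1..k}" "w = e j x" by blast
        have "P x w = (\<Sum>i\<in>{1..k}. if i = j then e i x else 0)"
          unfolding P_def by (intro sum.cong) (use orth[OF that(1) j(1)] j in auto)
        then show "P x w = id w" using j by simp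
      qed
      then show ?thesis by simp
    qed
  qed
qed

text \<open>
  A field \<open>Z\<close> tangent to \<open>W\<close> satisfies \<open>Z x = P x (Z x)\<close>. Differentiating at \<open>q\<close> shows that \<open>DZ(q) v\<close> is,
  modulo \<open>W q\<close>, the derivative of \<open>P\<close> along \<open>v\<close> applied to \<open>Z q\<close>, which involves \<open>Z\<close> only through its
  value at \<open>q\<close>. The same then holds for both terms of a bracket of tangent fields.
\<close>

lemma lie_bracket_tensorial:
  fixes W :: "'a::euclidean_space \<Rightarrow> 'a set"
  assumes N: "open N" "q \<in> N" and W: "distribution_on 1 N h W"
    and X: "Cr_on 1 N X" "Cr_on 1 N X'" "Cr_on 1 N Y" "Cr_on 1 N Y'"
    and tan: "tangent_field_on N X W" "tangent_field_on N X' W"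
      "tangent_field_on N Y W" "tangent_field_on N Y' W"
    and eq: "X q = X' q" "Y q = Y' q"
  shows "lie_bracket X Y q - lie_bracket X' Y' q \<in> W q"
proof -
  have sub: "subspace (W q)" using W N by (auto simp: distribution_on_def)
  obtain P :: "'a \<Rightarrow> 'a \<Rightarrow> 'a" where P: "\<And>x. linear (P x)" "\<And>z. Cr_on 1 N (\<lambda>x. P x z)"
    "\<And>x z. x \<in> N \<Longrightarrow> P x z \<in> W x" "\<And>x z. x \<in> N \<Longrightarrow> z \<in> W x \<Longrightarrow> P x z = z"
    using distribution_projection[OF N(1) W] by metis
  define P' where "P' v z = frechet_derivative (\<lambda>x. P x z) (at q) v" for v z
  have dP: "((\<lambda>x. P x z) has_derivative (\<lambda>v. P' v z)) (at q)" for z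
    unfolding P'_def using C1_onD(1)[OF P(2) N(2)] by simp
  have key: "frechet_derivative Z (at q) v - P' v (Z q) \<in> W q"
    if Z: "Cr_on 1 N Z" "tangent_field_on N Z W" for Z v
  proof -
    let ?Z' = "frechet_derivative Z (at q)"
    have dZ: "(Z has_derivative ?Z') (at q)" by (rule C1_onD(1)[OF Z(1) N(2)])
    have "((\<lambda>x. P x (Z x)) has_derivative (\<lambda>v. P' v (Z q) + P q (?Z' v))) (at q)"
      by (rule has_derivative_linear_field[OF N P(1) dP dZ])
    then have "(Z has_derivative (\<lambda>v. P' v (Z q) + P q (?Z' v))) (at q)"
      by (rule has_derivative_transform_within_open[OF _ N])
         (use P(4) Z(2) in \<open>auto simp: tangent_field_on_def\<close>)
    from has_derivative_unique[OF dZ this] have "?Z' v = P' v (Z q) + P q (?Z' v)" by metis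
    then have "?Z' v - P' v (Z q) = P q (?Z' v)" by (metis add_diff_cancel_left')
    then show ?thesis using P(3)[OF N(2)] by metis
  qed
  have "lie_bracket X Y q - lie_bracket X' Y' q =
      ((frechet_derivative Y (at q) (X q) - P' (X q) (Y q)) - (frechet_derivative X (at q) (Y q) - P' (Y q) (X q)))
    - ((frechet_derivative Y' (at q) (X' q) - P' (X' q) (Y' q)) - (frechet_derivative X' (at q) (Y' q) - P' (Y' q) (X' q)))"
    unfolding lie_bracket_def eq by simp
  also have "\<dots> \<in> W q"
    by (intro subspace_diff[OF sub] key X tan)
  finally show ?thesis .
qed

section \<open>Zero sets of \<open>C\<^sup>1\<close> maps\<close>

text \<open>
  The right-hand side is homogeneous, continuous and positive on the compact unit sphere of \<open>L\<close>.
\<close>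

lemma jointly_injective_imp_bounded_below:
  fixes T :: "'a::euclidean_space \<Rightarrow> 'c::euclidean_space" and A :: "'i \<Rightarrow> 'a \<Rightarrow> 'b::euclidean_space"
  assumes L: "subspace L" and T: "linear T" and I: "finite I" and A: "\<And>i. i \<in> I \<Longrightarrow> linear (A i)"
    and inj: "\<And>w. w \<in> L \<Longrightarrow> T w = 0 \<Longrightarrow> \<forall>i\<in>I. A i w = 0 \<Longrightarrow> w = 0"
  shows "\<exists>c>0. \<forall>w\<in>L. c * norm w \<le> norm (T w) + (\<Sum>i\<in>I. norm (A i w))"
proof -
  define \<phi> where "\<phi> w = norm (T w) + (\<Sum>i\<in>I. norm (A i w))" for w
  have scale: "\<phi> (c *\<^sub>R w) = \<bar>c\<bar> * \<phi> w" for c w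
    using T A by (simp add: \<phi>_def linear_cmul sum_distrib_left distrib_left)
  have pos: "0 < \<phi> w" if "w \<in> L" "w \<noteq> 0" for w
  proof -
    have "\<phi> w \<noteq> 0"
      using inj[OF that(1)] that(2) I by (auto simp: \<phi>_def add_nonneg_eq_0_iff sum_nonneg sum_nonneg_eq_0_iff)
    moreover have "0 \<le> \<phi> w" by (simp add: \<phi>_def sum_nonneg)
    ultimately show ?thesis by simp
  qed
  have "continuous_on (L \<inter> sphere 0 1) \<phi>"
    unfolding \<phi>_def using T A
    by (intro continuous_on_add continuous_on_sum continuous_on_norm linear_continuous_on)
       (auto simp: linear_conv_bounded_linear)
  moreover have "compact (L \<inter> sphere 0 1)"
    using closed_subspace[OF L] by (intro closed_Int_compact) auto
  ultimately obtain c where c: "0 < c" "\<And>w. w \<in> L \<inter> sphere 0 1 \<Longrightarrow> c \<le> \<phi> w"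
  proof (cases "L \<inter> sphere 0 1 = {}")
    case True
    then show ?thesis using that[of 1] by auto
  next
    case False
    then obtain m where m: "m \<in> L \<inter> sphere 0 1" "\<forall>w\<in>L \<inter> sphere 0 1. \<phi> m \<le> \<phi> w"
      using continuous_attains_inf[OF \<open>compact _\<close> False \<open>continuous_on _ _\<close>] by blast
    have "m \<noteq> 0" using m(1) by auto
    then show ?thesis using that[of "\<phi> m"] pos[of m] m by blast
  qed
  have "c * norm w \<le> \<phi> w" if w: "w \<in> L" for w
  proof (cases "w = 0")
    case False
    have "(1 / norm w) *\<^sub>R w \<in> L \<inter> sphere 0 1"
      using w False L by (simp add: subspace_scale)
    from c(2)[OF this] have "c \<le> \<phi> w / norm w" by (simp add: scale)
    then show ?thesis using False by (simp add: pos_le_divide_eq)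
  qed (auto simp: \<phi>_def sum_nonneg)
  then show ?thesis using c(1) unfolding \<phi>_def by blast
qed

text \<open>
  A substitute for the implicit function theorem. With \<open>T\<close> injective on the common kernel, \<open>T\<close> and the
  derivatives together control the norm on \<open>L\<close> from below. If \<open>y\<close> and \<open>z\<close> are both zeros near \<open>y0\<close>, then strict
  differentiability makes the derivatives small on \<open>y - z\<close>, so \<open>T\<close> alone controls \<open>y - z\<close>.
\<close>

lemma zero_set_lipschitz_chart:
  fixes g :: "'i \<Rightarrow> 'a::euclidean_space \<Rightarrow> 'b::euclidean_space"
  assumes O: "open O'" "y0 \<in> O'" and I: "finite I" and g: "\<And>i. i \<in> I \<Longrightarrow> Cr_on 1 O' (g i)"
    and L: "subspace L"
    and dim: "dim {v \<in> L. \<forall>i\<in>I. frechet_derivative (g i) (at y0) v = 0} \<le> DIM('c::euclidean_space)"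
  shows "\<exists>(T :: 'a \<Rightarrow> 'c) r C. linear T \<and> 0 < r \<and> 0 \<le> C \<and> cball y0 r \<subseteq> O' \<and>
    (\<forall>y\<in>cball y0 r. \<forall>z\<in>cball y0 r. y - z \<in> L \<longrightarrow> (\<forall>i\<in>I. g i y = 0 \<and> g i z = 0) \<longrightarrow>
      norm (y - z) \<le> C * norm (T y - T z))"
proof -
  define A where "A i = frechet_derivative (g i) (at y0)" for i
  have linA: "linear (A i)" if "i \<in> I" for i
    unfolding A_def using g[OF that] O(2) by (rule linear_derivative)
  let ?K = "{v \<in> L. \<forall>i\<in>I. A i v = 0}"
  have "subspace ?K"
    using L linA by (auto simp: subspace_def linear_0 linear_add linear_cmul)
  then obtain T :: "'a \<Rightarrow> 'c" where T: "linear T" "\<And>x. x \<in> ?K \<Longrightarrow> norm (T x) = norm x"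
    using isometry_subset_subspace[of ?K "UNIV :: 'c set"] dim by (auto simp: A_def)
  have "w = 0" if "w \<in> L" "T w = 0" "\<forall>i\<in>I. A i w = 0" for w
    using T(2)[of w] that by simp
  from jointly_injective_imp_bounded_below[where A = A, OF L T(1) I linA this]
  obtain c where c: "0 < c" "\<And>w. w \<in> L \<Longrightarrow> c * norm w \<le> norm (T w) + (\<Sum>i\<in>I. norm (A i w))"
    by blast
  \<comment> \<open>With at most \<open>card I\<close> errors of size \<open>\<delta>\<close>, half of the lower bound \<open>c\<close> survives.\<close>
  define \<delta> where "\<delta> = c / (2 * (real (card I) + 1))"
  have \<delta>: "0 < \<delta>" "real (card I) * \<delta> \<le> c / 2"
    using c(1) by (auto simp: \<delta>_def field_simps)
  have "\<forall>i\<in>I. \<exists>r>0. \<forall>y\<in>cball y0 r. \<forall>z\<in>cball y0 r.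
      norm (g i y - g i z - A i (y - z)) \<le> \<delta> * norm (y - z)"
    using C1_on_strict_derivative[OF O g \<delta>(1)] unfolding A_def by blast
  then obtain \<rho> where \<rho>: "\<And>i. i \<in> I \<Longrightarrow> 0 < \<rho> i"
    "\<And>i y z. i \<in> I \<Longrightarrow> y \<in> cball y0 (\<rho> i) \<Longrightarrow> z \<in> cball y0 (\<rho> i) \<Longrightarrow>
      norm (g i y - g i z - A i (y - z)) \<le> \<delta> * norm (y - z)"
    by metis
  obtain r0 where r0: "0 < r0" "cball y0 r0 \<subseteq> O'" using O open_contains_cball by blast
  define r where "r = Min (insert r0 (\<rho> ` I))"
  have r: "0 < r" "r \<le> r0" "\<And>i. i \<in> I \<Longrightarrow> r \<le> \<rho> i"
    using I r0 \<rho>(1) by (auto simp: r_def)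
  have "norm (y - z) \<le> (2 / c) * norm (T y - T z)"
    if y: "y \<in> cball y0 r" and z: "z \<in> cball y0 r" and L: "y - z \<in> L"
      and 0: "\<forall>i\<in>I. g i y = 0 \<and> g i z = 0" for y z
  proof -
    have "norm (A i (y - z)) \<le> \<delta> * norm (y - z)" if i: "i \<in> I" for i
      using \<rho>(2)[OF i, of y z] y z r(3)[OF i] 0 i by auto
    then have "(\<Sum>i\<in>I. norm (A i (y - z))) \<le> (\<Sum>i\<in>I. \<delta> * norm (y - z))"
      by (rule sum_mono)
    also have "\<dots> = (real (card I) * \<delta>) * norm (y - z)" by simp
    also have "\<dots> \<le> c / 2 * norm (y - z)" by (intro mult_right_mono \<delta>) auto
    finally have "c * norm (y - z) \<le> norm (T (y - z)) + c / 2 * norm (y - z)"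
      using c(2)[OF L] by linarith
    then have "c * norm (y - z) \<le> 2 * norm (T y - T z)"
      by (simp add: linear_diff[OF T(1)])
    then show ?thesis using c(1) by (simp add: field_simps)
  qed
  moreover have "cball y0 r \<subseteq> O'" using r0 r(2) by force
  ultimately show ?thesis
    using T(1) r(1) c(1) by (intro exI[of _ T] exI[of _ r] exI[of _ "2 / c"]) auto
qed

section \<open>Tangent spaces in a flattening chart\<close>

locale C2_flattening =
  fixes S U :: "'a::euclidean_space set" and \<Phi> \<Psi> :: "'a \<Rightarrow> 'a" and L :: "'a set"
  assumes open_U: "open U" and open_image: "open (\<Phi> ` U)"
    and C2_\<Phi>: "Cr_on 2 U \<Phi>" and C2_\<Psi>: "Cr_on 2 (\<Phi> ` U) \<Psi>"
    and inverse: "x \<in> U \<Longrightarrow> \<Psi> (\<Phi> x) = x"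
    and subspace_L: "subspace L" and flat: "\<Phi> ` (S \<inter> U) = \<Phi> ` U \<inter> L"
begin

abbreviation "D\<Phi> x \<equiv> frechet_derivative \<Phi> (at x)"
abbreviation "D\<Psi> y \<equiv> frechet_derivative \<Psi> (at y)"

lemmas C1_\<Phi> = C2_on_imp_C1_on[OF C2_\<Phi>] and C1_\<Psi> = C2_on_imp_C1_on[OF C2_\<Psi>]

lemma derivative_inverse:
  assumes "y \<in> \<Phi> ` U"
  shows "D\<Psi> y (D\<Phi> (\<Psi> y) v) = v" and "D\<Phi> (\<Psi> y) (D\<Psi> y w) = w"
proof -
  obtain x where x: "x \<in> U" "y = \<Phi> x" "\<Psi> y = x" using assms inverse by auto
  have d\<Phi>: "(\<Phi> has_derivative D\<Phi> x) (at x)" using C1_\<Phi> x(1) by (rule C1_onD(1))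
  have d\<Psi>: "(\<Psi> has_derivative D\<Psi> y) (at y)" using C1_\<Psi> assms by (rule C1_onD(1))
  have "((\<lambda>x. \<Psi> (\<Phi> x)) has_derivative (\<lambda>v. D\<Psi> y (D\<Phi> x v))) (at x)"
    using d\<Phi> d\<Psi>[unfolded x(2)] unfolding x(2) by (rule has_derivative_compose)
  then have "((\<lambda>x. x) has_derivative (\<lambda>v. D\<Psi> y (D\<Phi> x v))) (at x)"
    by (rule has_derivative_transform_within_open[OF _ open_U x(1)]) (rule inverse)
  from fun_cong[OF has_derivative_unique[OF this has_derivative_ident], of v]
  show "D\<Psi> y (D\<Phi> (\<Psi> y) v) = v" unfolding x(3) .
  have "((\<lambda>y. \<Phi> (\<Psi> y)) has_derivative (\<lambda>w. D\<Phi> x (D\<Psi> y w))) (at y)"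
    using d\<Psi> d\<Phi>[folded x(3)] unfolding x(3)[symmetric] by (rule has_derivative_compose)
  then have "((\<lambda>y. y) has_derivative (\<lambda>w. D\<Phi> x (D\<Psi> y w))) (at y)"
    by (rule has_derivative_transform_within_open[OF _ open_image assms])
       (elim imageE, simp only: inverse)
  from fun_cong[OF has_derivative_unique[OF this has_derivative_ident], of w]
  show "D\<Phi> (\<Psi> y) (D\<Psi> y w) = w" unfolding x(3) .
qed

lemma \<Psi>_in: "y \<in> \<Phi> ` U \<Longrightarrow> \<Psi> y \<in> U" "y \<in> \<Phi> ` U \<Longrightarrow> y \<in> L \<Longrightarrow> \<Psi> y \<in> S"
proof -
  show "\<Psi> y \<in> U" if "y \<in> \<Phi> ` U" using that inverse by auto
  assume "y \<in> \<Phi> ` U" "y \<in> L"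
  then have "y \<in> \<Phi> ` (S \<inter> U)" using flat by simp
  then show "\<Psi> y \<in> S" using inverse by auto
qed

text \<open>
  Images under \<open>\<Psi>\<close> of straight lines in \<open>L\<close> realize every vector on the right. Conversely, \<open>\<Phi>\<close> carries a
  curve in \<open>S\<close> to a curve in \<open>L\<close>, whose velocity lies in \<open>L\<close>.
\<close>

lemma Tan_eq:
  assumes y: "y \<in> \<Phi> ` U" "y \<in> L"
  shows "Tan S (\<Psi> y) = D\<Psi> y ` L"
proof (intro equalityI subsetI)
  fix v assume "v \<in> D\<Psi> y ` L"
  then obtain t where t: "t \<in> L" "v = D\<Psi> y t" by blast
  obtain r where r: "0 < r" "ball y r \<subseteq> \<Phi> ` U" using open_image y(1) open_contains_ball by blast
  define \<epsilon> where "\<epsilon> = r / (norm t + 1)"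
  define \<gamma> where "\<gamma> s = \<Psi> (y + s *\<^sub>R t)" for s :: real
  have nt: "0 < norm t + 1" by (simp add: add_nonneg_pos)
  then have \<epsilon>: "0 < \<epsilon>" using r by (simp add: \<epsilon>_def)
  have inO: "y + s *\<^sub>R t \<in> \<Phi> ` U" if s: "s \<in> {-\<epsilon><..<\<epsilon>}" for s
  proof -
    have "\<bar>s\<bar> * (norm t + 1) < r"
      using s nt by (auto simp: \<epsilon>_def field_simps abs_less_iff)
    moreover have "\<bar>s\<bar> * norm t \<le> \<bar>s\<bar> * (norm t + 1)" by (intro mult_left_mono) auto
    moreover have "dist y (y + s *\<^sub>R t) = \<bar>s\<bar> * norm t" by (simp add: dist_norm)
    ultimately have "y + s *\<^sub>R t \<in> ball y r" by simp
    then show ?thesis using r by blast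
  qed
  have line: "Cr_on 1 {-\<epsilon><..<\<epsilon>} (\<lambda>s::real. y + s *\<^sub>R t)"
    by (rule C1_onI[where f' = "\<lambda>s h. h *\<^sub>R t"]) (auto intro!: derivative_eq_intros)
  have \<gamma>C1: "Cr_on 1 {-\<epsilon><..<\<epsilon>} \<gamma>"
    unfolding \<gamma>_def by (rule C1_on_compose[OF line C1_\<Psi>]) (use inO in blast)
  have "\<gamma> C1_differentiable_on {-\<epsilon><..<\<epsilon>}"
    unfolding C1_differentiable_on_def
  proof (intro exI conjI ballI)
    show "(\<gamma> has_vector_derivative frechet_derivative \<gamma> (at s) 1) (at s)"
      if s: "s \<in> {-\<epsilon><..<\<epsilon>}" for s
    proof -
      have "frechet_derivative \<gamma> (at s) h = h *\<^sub>R frechet_derivative \<gamma> (at s) 1" for h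
        using linear_cmul[OF linear_derivative[OF \<gamma>C1 s], of h 1] by simp
      then have "frechet_derivative \<gamma> (at s) = (\<lambda>h. h *\<^sub>R frechet_derivative \<gamma> (at s) 1)" by (rule ext)
      from has_derivative_eq_rhs[OF C1_onD(1)[OF \<gamma>C1 s] this]
      show ?thesis unfolding has_vector_derivative_def .
    qed
    show "continuous_on {-\<epsilon><..<\<epsilon>} (\<lambda>s. frechet_derivative \<gamma> (at s) 1)"
      by (rule C1_onD(2)[OF \<gamma>C1])
  qed
  moreover have "\<gamma> ` {-\<epsilon><..<\<epsilon>} \<subseteq> S"
  proof (rule image_subsetI)
    fix s assume "s \<in> {-\<epsilon><..<\<epsilon>}"
    moreover have "y + s *\<^sub>R t \<in> L"
      by (intro subspace_add subspace_scale subspace_L y(2) t(1))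
    ultimately show "\<gamma> s \<in> S" unfolding \<gamma>_def by (intro \<Psi>_in(2) inO)
  qed
  moreover have "(\<gamma> has_vector_derivative v) (at 0)"
  proof -
    have d: "((\<lambda>s::real. y + s *\<^sub>R t) has_derivative (\<lambda>h. h *\<^sub>R t)) (at 0)"
      by (auto intro!: derivative_eq_intros)
    have "(\<Psi> has_derivative D\<Psi> y) (at (y + 0 *\<^sub>R t))"
      using C1_onD(1)[OF C1_\<Psi> y(1)] by simp
    from has_derivative_compose[OF d this]
    have "(\<gamma> has_derivative (\<lambda>h. D\<Psi> y (h *\<^sub>R t))) (at 0)" by (simp add: \<gamma>_def[abs_def])
    then show ?thesis
      unfolding has_vector_derivative_def t(2) linear_cmul[OF linear_derivative[OF C1_\<Psi> y(1)]] .
  qed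
  moreover have "\<gamma> 0 = \<Psi> y" by (simp add: \<gamma>_def)
  ultimately show "v \<in> Tan S (\<Psi> y)" using \<epsilon> unfolding Tan_def by blast
next
  fix v assume "v \<in> Tan S (\<Psi> y)"
  then obtain \<gamma> :: "real \<Rightarrow> 'a" and \<epsilon> where \<epsilon>: "0 < \<epsilon>" and \<gamma>: "\<gamma> ` {-\<epsilon><..<\<epsilon>} \<subseteq> S"
    "\<gamma> 0 = \<Psi> y" "(\<gamma> has_vector_derivative v) (at 0)"
    unfolding Tan_def by blast
  define w where "w = D\<Phi> (\<Psi> y) v"
  have d\<Phi>: "(\<Phi> has_derivative D\<Phi> (\<Psi> y)) (at (\<gamma> 0))"
    using C1_onD(1)[OF C1_\<Phi> \<Psi>_in(1)[OF y(1)]] \<gamma>(2) by simp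
  have d\<gamma>: "((\<lambda>s. \<Phi> (\<gamma> s)) has_derivative (\<lambda>h. D\<Phi> (\<Psi> y) (h *\<^sub>R v))) (at 0)"
    using has_derivative_compose[OF \<gamma>(3)[unfolded has_vector_derivative_def] d\<Phi>] .
  \<comment> \<open>The curve \<open>\<Phi> \<circ> \<gamma>\<close> stays in \<open>L\<close>, so its velocity has no component orthogonal to \<open>L\<close>.\<close>
  obtain a z where az: "a \<in> span L" "\<And>l. l \<in> span L \<Longrightarrow> orthogonal z l" "w = a + z"
    using orthogonal_subspace_decomp_exists[of L w] by metis
  have "isCont \<gamma> 0" using \<gamma>(3) has_vector_derivative_continuous by blast
  then have "(\<gamma> \<longlongrightarrow> \<gamma> 0) (nhds 0)" using tendsto_at_iff_tendsto_nhds[of \<gamma> 0] by (simp add: isCont_def)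
  then have "\<forall>\<^sub>F s in nhds 0. \<gamma> s \<in> U"
    using \<Psi>_in(1)[OF y(1)] \<gamma>(2) open_U by (simp add: topological_tendstoD)
  moreover have "\<forall>\<^sub>F s in nhds 0. s \<in> {-\<epsilon><..<\<epsilon>}"
    using \<epsilon> by (intro eventually_nhds_in_open) auto
  ultimately have "\<forall>\<^sub>F s in nhds 0. \<Phi> (\<gamma> s) \<bullet> z = 0"
  proof eventually_elim
    case (elim s)
    then have "\<Phi> (\<gamma> s) \<in> L" using \<gamma>(1) flat by blast
    then have "orthogonal z (\<Phi> (\<gamma> s))" using az(2) span_base by blast
    then show ?case by (simp add: orthogonal_def inner_commute)
  qed
  then obtain N where N: "open N" "0 \<in> N" "\<And>s. s \<in> N \<Longrightarrow> \<Phi> (\<gamma> s) \<bullet> z = 0"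
    unfolding eventually_nhds by blast
  have "((\<lambda>s. \<Phi> (\<gamma> s) \<bullet> z) has_derivative (\<lambda>h. D\<Phi> (\<Psi> y) (h *\<^sub>R v) \<bullet> z)) (at 0)"
    using d\<gamma> by (rule has_derivative_inner_left)
  then have "((\<lambda>s. 0) has_derivative (\<lambda>h. D\<Phi> (\<Psi> y) (h *\<^sub>R v) \<bullet> z)) (at 0)"
    by (rule has_derivative_transform_within_open[OF _ N(1,2)]) (rule N(3))
  from fun_cong[OF has_derivative_unique[OF this has_derivative_const], of 1]
  have "w \<bullet> z = 0" unfolding w_def by simp
  moreover have "a \<bullet> z = 0" using az(1,2) by (metis orthogonal_def inner_commute)
  ultimately have "z = 0" using az(3) by (simp add: inner_add_left)
  then have "w \<in> L" using az(1,3) span_eq_iff[THEN iffD2, OF subspace_L] by simp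
  moreover have "v = D\<Psi> y w" unfolding w_def using derivative_inverse(1)[OF y(1)] by simp
  ultimately show "v \<in> D\<Psi> y ` L" by blast
qed

end

section \<open>The tangency defect\<close>

locale C2_flattening_with_projection = C2_flattening +
  fixes V :: "'a \<Rightarrow> 'a set" and P :: "'a \<Rightarrow> 'a \<Rightarrow> 'a"
  assumes linear_P: "\<And>x. linear (P x)" and C1_P: "\<And>z. Cr_on 1 UNIV (\<lambda>x. P x z)"
    and P_in: "\<And>x z. P x z \<in> V x" and P_id: "\<And>x z. z \<in> V x \<Longrightarrow> P x z = z"
begin

definition defect :: "'a \<Rightarrow> 'a \<Rightarrow> 'a" where
  "defect t y = D\<Psi> y t - P (\<Psi> y) (D\<Psi> y t)"

lemma linear_defect: "y \<in> \<Phi> ` U \<Longrightarrow> linear (\<lambda>t. defect t y)"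
proof -
  assume "y \<in> \<Phi> ` U"
  then have D: "linear (D\<Psi> y)" by (rule linear_derivative[OF C1_\<Psi>])
  show ?thesis
    unfolding defect_def
    using linear_compose_sub[OF D linear_compose[OF D linear_P[of "\<Psi> y"]]] by (simp only: o_def)
qed

lemma C1_projected_velocity: "Cr_on 1 (\<Phi> ` U) (\<lambda>y. P (\<Psi> y) (D\<Psi> y t))"
proof (rule C1_on_linear_field[OF open_image linear_P])
  show "Cr_on 1 (\<Phi> ` U) (\<lambda>y. P (\<Psi> y) z)" for z
    by (rule C1_on_compose[OF C1_\<Psi> C1_P]) simp
qed (rule C2_on_derivative[OF C2_\<Psi>])

lemma C1_defect: "Cr_on 1 (\<Phi> ` U) (defect t)"
  unfolding defect_def[abs_def]
  by (rule C1_on_diff[OF C2_on_derivative[OF C2_\<Psi>] C1_projected_velocity])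

lemma defect_eq_0_iff: "defect t y = 0 \<longleftrightarrow> D\<Psi> y t \<in> V (\<Psi> y)"
  unfolding defect_def using P_in[of "\<Psi> y" "D\<Psi> y t"] P_id[of "D\<Psi> y t" "\<Psi> y"] by auto

lemma tangency_iff_defect:
  assumes y: "y \<in> \<Phi> ` U" "y \<in> L" and B: "span B = L"
  shows "\<Psi> y \<in> tangency_set S V \<longleftrightarrow> (\<forall>t\<in>B. defect t y = 0)"
proof -
  have "\<Psi> y \<in> tangency_set S V \<longleftrightarrow> (\<forall>t\<in>L. defect t y = 0)"
    using Tan_eq[OF y] \<Psi>_in(2)[OF y] by (auto simp: tangency_set_def defect_eq_0_iff)
  also have "\<dots> \<longleftrightarrow> (\<forall>t\<in>B. defect t y = 0)"
    using linear_eq_0_on_span[OF linear_defect[OF y(1)]] span_superset[of B] B by blast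
  finally show ?thesis .
qed

text \<open>
  This is where non-involutivity enters. If the common kernel were large, it would contain an
  \<open>h\<close>-dimensional \<open>T\<close>, and the distribution \<open>W x = A x ` T\<close>, with \<open>A x t = P x (D\<Psi>(\<Phi> x) t)\<close>, would be
  involutive at \<open>\<Psi> y0\<close>: along \<open>D\<Psi>(y0) T\<close> the derivative of \<open>A x t\<close> is that of the coordinate field \<open>D\<Psi>(\<Phi> x) t\<close>, because the defect
  contributes nothing, and coordinate fields commute.
\<close>

lemma dim_kernel_derivative_defect_less:
  assumes ni: "h_non_involutive_at h V (\<Psi> y0)"
    and y0: "y0 \<in> \<Phi> ` U" "\<And>t. t \<in> L \<Longrightarrow> defect t y0 = 0"
  shows "dim {v \<in> L. \<forall>t\<in>L. frechet_derivative (defect t) (at y0) v = 0} < h" (is "dim ?K < h")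
proof (rule ccontr)
  assume "\<not> dim ?K < h"
  have lind: "linear (frechet_derivative (defect t) (at y0))" for t
    by (rule linear_derivative[OF C1_defect y0(1)])
  have subK: "subspace ?K"
    using subspace_L by (auto simp: subspace_def linear_0[OF lind] linear_add[OF lind] linear_cmul[OF lind])
  obtain T where T: "subspace T" "T \<subseteq> ?K" "dim T = h"
  proof -
    have "h \<le> dim ?K" using \<open>\<not> dim ?K < h\<close> by simp
    then obtain T where "subspace T" "T \<subseteq> span ?K" "dim T = h"
      by (rule choose_subspace_of_subspace)
    moreover have "span ?K = ?K" using subK by (rule span_eq_iff[THEN iffD2])
    ultimately show ?thesis using that by simp
  qed
  obtain B where B: "B \<subseteq> T" "pairwise orthogonal B" "\<And>x. x \<in> B \<Longrightarrow> norm x = 1"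
    "independent B" "card B = h" "span B = T"
    using orthonormal_basis_subspace[OF T(1)] T(3) by metis
  have finB: "finite B" using B(4) by (rule independent_imp_finite)
  define q where "q = \<Psi> y0"
  have q: "q \<in> U" "\<Phi> q = y0" using y0(1) inverse by (auto simp: q_def)
  define A where "A x t = P x (D\<Psi> (\<Phi> x) t)" for x t
  have linA: "linear (A x)" if "x \<in> U" for x
    unfolding A_def
    using linear_compose[OF linear_derivative[OF C1_\<Psi>] linear_P, of "\<Phi> x" x] that by (simp add: o_def)
  have A_\<Phi>: "A x t = D\<Psi> (\<Phi> x) t - defect t (\<Phi> x)" if "x \<in> U" for x t
    using inverse[OF that] by (simp add: A_def defect_def)
  have Aq: "A q t = D\<Psi> y0 t" if "t \<in> T" for t
    using A_\<Phi>[OF q(1)] y0(2) T(2) that by (auto simp: q(2))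
  have C1A: "Cr_on 1 U (\<lambda>x. A x t)" for t
  proof (rule C1_on_cong[OF open_U])
    show "Cr_on 1 U (\<lambda>x. D\<Psi> (\<Phi> x) t - defect t (\<Phi> x))"
      by (rule C1_on_diff[OF C1_on_compose[OF C1_\<Phi> C2_on_derivative[OF C2_\<Psi>]]
            C1_on_compose[OF C1_\<Phi> C1_defect]]) auto
  qed (rule A_\<Phi>[symmetric])
  have "bounded_linear (A q)" using linA[OF q(1)] by (simp add: linear_conv_bounded_linear)
  moreover have "\<forall>t\<in>T. A q t = 0 \<longrightarrow> t = 0"
  proof (intro ballI impI)
    fix t assume "t \<in> T" "A q t = 0"
    then have "D\<Psi> y0 t = 0" using Aq by simp
    then show "t = 0"
      using derivative_inverse(2)[OF y0(1), of t] linear_0[OF linear_derivative[OF C1_\<Phi> q(1)]]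
      by (simp add: q_def)
  qed
  ultimately obtain c where c: "0 < c" "\<And>t. t \<in> T \<Longrightarrow> c * norm t \<le> norm (A q t)"
    using injective_imp_isometric[OF closed_subspace[OF T(1)] T(1)] by blast
  \<comment> \<open>A perturbation of \<open>A q\<close> by less than \<open>d\<close> on each of the \<open>h\<close> orthonormal basis vectors stays injective on \<open>T\<close>.\<close>
  define d where "d = c / (real h + 1)"
  have d: "0 < d" "real h * d < c" using c(1) by (auto simp: d_def field_simps)
  have "\<forall>\<^sub>F x in nhds q. x \<in> U \<and> (\<forall>b\<in>B. dist (A x b) (A q b) < d)"
  proof (intro eventually_conj eventually_ball_finite ballI finB)
    show "\<forall>\<^sub>F x in nhds q. x \<in> U" using open_U q(1) by (rule eventually_nhds_in_open)
    show "\<forall>\<^sub>F x in nhds q. dist (A x b) (A q b) < d" for b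
    proof -
      have "isCont (\<lambda>x. A x b) q"
        using C1_on_imp_continuous_on[OF C1A] open_U q(1) by (simp add: continuous_on_eq_continuous_at)
      then have "((\<lambda>x. A x b) \<longlongrightarrow> A q b) (nhds q)"
        by (metis (no_types) isCont_def tendsto_at_iff_tendsto_nhds)
      then show ?thesis using d(1) by (rule tendstoD)
    qed
  qed
  then obtain N where N: "open N" "q \<in> N" "\<And>x. x \<in> N \<Longrightarrow> x \<in> U"
    "\<And>x b. x \<in> N \<Longrightarrow> b \<in> B \<Longrightarrow> dist (A x b) (A q b) < d"
    unfolding eventually_nhds by blast
  have injA: "inj_on (A x) T" if x: "x \<in> N" for x
  proof -
    have "t = 0" if t: "t \<in> T" "A x t = 0" for t
    proof (rule ccontr)
      assume "t \<noteq> 0"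
      have "t = (\<Sum>b\<in>B. (t \<bullet> b) *\<^sub>R b)"
        using orthonormal_basis_expand[OF B(2,3) _ finB] t(1) B(6) by simp
      moreover have lin: "linear (\<lambda>t. A q t - A x t)"
        by (intro linear_compose_sub linA q(1) N(3)[OF x])
      ultimately have "A q t - A x t = (\<Sum>b\<in>B. A q ((t \<bullet> b) *\<^sub>R b) - A x ((t \<bullet> b) *\<^sub>R b))"
        using linear_sum[OF lin, of "\<lambda>b. (t \<bullet> b) *\<^sub>R b" B] by simp
      also have "\<dots> = (\<Sum>b\<in>B. (t \<bullet> b) *\<^sub>R (A q b - A x b))"
        using linear_cmul[OF lin] by (intro sum.cong) auto
      finally have "norm (A q t) \<le> (\<Sum>b\<in>B. norm ((t \<bullet> b) *\<^sub>R (A q b - A x b)))"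
        using norm_sum[of "\<lambda>b. (t \<bullet> b) *\<^sub>R (A q b - A x b)" B] t(2) by simp
      also have "\<dots> \<le> (\<Sum>b\<in>B. norm t * d)"
      proof (rule sum_mono)
        fix b assume b: "b \<in> B"
        have "\<bar>t \<bullet> b\<bar> \<le> norm t" using Cauchy_Schwarz_ineq2[of t b] B(3)[OF b] by simp
        moreover have "norm (A q b - A x b) \<le> d"
          using N(4)[OF x b] by (simp add: dist_norm norm_minus_commute)
        ultimately show "norm ((t \<bullet> b) *\<^sub>R (A q b - A x b)) \<le> norm t * d"
          by (simp add: mult_mono)
      qed
      also have "\<dots> = (real h * d) * norm t" using B(5) by simp
      also have "\<dots> < c * norm t" using d(2) \<open>t \<noteq> 0\<close> by simp
      finally show False using c(2)[OF t(1)] by simp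
    qed
    then show ?thesis
      using linear_injective_on_subspace_0[OF linA[OF N(3)[OF x]] T(1)] by blast
  qed
  define W where "W x = A x ` T" for x
  have NU: "N \<subseteq> U" using N(3) by blast
  have W: "distribution_on 1 N h W"
  proof -
    obtain \<beta> where \<beta>: "bij_betw \<beta> {1..h} B"
      using ex_bij_betw_nat_finite_1[OF finB] B(5) by auto
    have "W x = span ((\<lambda>i. A x (\<beta> i)) ` {1..h})" if "x \<in> N" for x
    proof -
      have "span ((\<lambda>i. A x (\<beta> i)) ` {1..h}) = span (A x ` B)"
        using bij_betw_imp_surj_on[OF \<beta>] by (metis image_image)
      then show ?thesis
        using linear_span_image[OF linA[OF N(3)[OF that]]] B(6) by (simp add: W_def)
    qed
    moreover have "subspace (W x) \<and> dim (W x) = h" if "x \<in> N" for x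
      using dim_image_eq[OF linA[OF N(3)[OF that]], of T] injA[OF that] T
        linear_subspace_image[OF linA[OF N(3)[OF that]] T(1)]
      by (simp add: W_def span_eq_iff[THEN iffD2])
    moreover have "\<forall>i\<in>{1..h}. Cr_on 1 N (\<lambda>x. A x (\<beta> i))"
      using C1_on_subset[OF C1A NU] by blast
    ultimately show ?thesis
      unfolding distribution_on_def by (intro conjI exI[of _ "\<lambda>i x. A x (\<beta> i)"] ballI) auto
  qed
  have "tangent_distribution_on N W V"
    unfolding tangent_distribution_on_def W_def A_def using P_in by blast
  then have "non_involutive_at N W q"
    using ni N(1,2) W unfolding h_non_involutive_at_def q_def by blast
  then obtain M X Y where M: "open M" "q \<in> M" "M \<subseteq> N" and XY: "Cr_on 1 M X" "Cr_on 1 M Y"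
    "tangent_field_on M X W" "tangent_field_on M Y W" and bracket: "lie_bracket X Y q \<notin> W q"
    unfolding non_involutive_at_def by blast
  obtain a b where ab: "a \<in> T" "X q = A q a" "b \<in> T" "Y q = A q b"
    using XY(3,4) M(2) unfolding tangent_field_on_def W_def by blast
  have WM: "distribution_on 1 M h W" using distribution_on_subset[OF W M(3)] .
  have CA: "Cr_on 1 M (\<lambda>x. A x t)" for t
    using C1_on_subset[OF C1A] M(3) NU by blast
  have tA: "tangent_field_on M (\<lambda>x. A x t) W" if "t \<in> T" for t
    using that by (simp add: tangent_field_on_def W_def)
  have "lie_bracket X Y q - lie_bracket (\<lambda>x. A x a) (\<lambda>x. A x b) q \<in> W q"
    using ab tA by (intro lie_bracket_tensorial[OF M(1,2) WM XY(1) CA XY(2) CA XY(3) _ XY(4)]) auto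
  moreover have "lie_bracket (\<lambda>x. A x a) (\<lambda>x. A x b) q = 0"
  proof -
    have dA: "frechet_derivative (\<lambda>x. A x t) (at q) (A q s)
        = frechet_derivative (\<lambda>y. D\<Psi> y t) (at y0) s" if st: "s \<in> T" "t \<in> T" for s t
    proof -
      let ?G = "\<lambda>y. D\<Psi> y t - defect t y"
      have "(?G has_derivative (\<lambda>v. frechet_derivative (\<lambda>y. D\<Psi> y t) (at y0) v
          - frechet_derivative (defect t) (at y0) v)) (at y0)"
        by (rule has_derivative_diff[OF C1_onD(1)[OF C2_on_derivative[OF C2_\<Psi>] y0(1)]
              C1_onD(1)[OF C1_defect y0(1)]])
      then have "((\<lambda>x. ?G (\<Phi> x)) has_derivative
          (\<lambda>v. frechet_derivative (\<lambda>y. D\<Psi> y t) (at y0) (D\<Phi> q v)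
          - frechet_derivative (defect t) (at y0) (D\<Phi> q v))) (at q)"
        by (intro has_derivative_compose[OF C1_onD(1)[OF C1_\<Phi> q(1)]]) (simp add: q(2))
      then have "((\<lambda>x. A x t) has_derivative
          (\<lambda>v. frechet_derivative (\<lambda>y. D\<Psi> y t) (at y0) (D\<Phi> q v)
          - frechet_derivative (defect t) (at y0) (D\<Phi> q v))) (at q)"
        by (rule has_derivative_transform_within_open[OF _ open_U q(1)]) (rule A_\<Phi>[symmetric])
      from fun_cong[OF frechet_derivative_at[OF this], of "A q s", symmetric]
      have "frechet_derivative (\<lambda>x. A x t) (at q) (A q s)
          = frechet_derivative (\<lambda>y. D\<Psi> y t) (at y0) s - frechet_derivative (defect t) (at y0) s"
        using Aq[OF st(1)] derivative_inverse(2)[OF y0(1)] by (simp add: q_def)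
      moreover have "frechet_derivative (defect t) (at y0) s = 0"
        using T(2) st by blast
      ultimately show ?thesis by simp
    qed
    show ?thesis
      unfolding lie_bracket_def using dA ab symmetric_second_derivative[OF open_image y0(1) C2_\<Psi>, of a b]
      by simp
  qed
  ultimately show False using bracket by simp
qed

text \<open>
  In a small closed ball of the chart, the tangency set corresponds to the compact zero set \<open>Z\<close> of the
  defects. A linear map \<open>T\<close> to \<open>\<real>\<^sup>h\<^sup>-\<^sup>1\<close> has a Lipschitz inverse on \<open>Z\<close>, and this inverse followed by
  \<open>\<Psi>\<close> maps the compact set \<open>T ` Z\<close> onto the tangency set in that ball.
\<close>

lemma local_lipschitz_image:
  assumes ni: "h_non_involutive_at h V q" and p: "h - 1 = CARD('p::finite)"
    and q: "q \<in> U" "q \<in> tangency_set S V"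
  shows "\<exists>U' (K :: (real ^ 'p) set) f. open U' \<and> q \<in> U' \<and> compact K \<and>
    (\<exists>C. C-lipschitz_on K f) \<and> tangency_set S V \<inter> U' \<subseteq> f ` K \<and> f ` K \<subseteq> tangency_set S V"
proof -
  define y0 where "y0 = \<Phi> q"
  have y0: "y0 \<in> \<Phi> ` U" "\<Psi> y0 = q" using q(1) inverse by (auto simp: y0_def)
  have y0L: "y0 \<in> L" using q flat by (auto simp: y0_def tangency_set_def)
  obtain B where B: "finite B" "span B = L" using basis_subspace_exists[OF subspace_L] by metis
  have BL: "B \<subseteq> L" using B(2) span_superset by blast
  have def0: "defect t y0 = 0" if "t \<in> L" for t
    using tangency_iff_defect[OF y0(1) y0L, of L] q(2) y0(2) that subspace_L span_eq_iff by auto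
  \<comment> \<open>Finitely many defects suffice, since the defect and its derivative are linear in \<open>t\<close>.\<close>
  have linD: "linear (\<lambda>t. frechet_derivative (defect t) (at y0) v)" for v
    using linear_derivative_of_linear_field[OF open_image y0(1), of "\<lambda>y t. defect t y"
        "\<lambda>v t. frechet_derivative (defect t) (at y0) v"]
      linear_defect C1_onD(1)[OF C1_defect y0(1)] by blast
  have "{v \<in> L. \<forall>t\<in>B. frechet_derivative (defect t) (at y0) v = 0}
      = {v \<in> L. \<forall>t\<in>L. frechet_derivative (defect t) (at y0) v = 0}"
    using linear_eq_0_on_span[OF linD] B(2) BL by blast
  moreover have "dim {v \<in> L. \<forall>t\<in>L. frechet_derivative (defect t) (at y0) v = 0} < h"
    by (rule dim_kernel_derivative_defect_less) (use ni y0 def0 in auto)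
  ultimately have "dim {v \<in> L. \<forall>t\<in>B. frechet_derivative (defect t) (at y0) v = 0}
      \<le> DIM(real ^ 'p)"
    using p by simp
  from zero_set_lipschitz_chart[where g = defect, OF open_image y0(1) B(1) C1_defect subspace_L this]
  obtain T :: "'a \<Rightarrow> real ^ 'p" and r1 C where T: "linear T" and r1: "0 < r1" "0 \<le> C" "cball y0 r1 \<subseteq> \<Phi> ` U"
    and chart: "\<And>y z. y \<in> cball y0 r1 \<Longrightarrow> z \<in> cball y0 r1 \<Longrightarrow> y - z \<in> L \<Longrightarrow>
      \<forall>t\<in>B. defect t y = 0 \<and> defect t z = 0 \<Longrightarrow> norm (y - z) \<le> C * norm (T y - T z)"
    by blast
  obtain r2 where r2: "0 < r2" "\<And>y z. y \<in> cball y0 r2 \<Longrightarrow> z \<in> cball y0 r2 \<Longrightarrow>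
      norm (\<Psi> y - \<Psi> z - D\<Psi> y0 (y - z)) \<le> 1 * norm (y - z)"
    using C1_on_strict_derivative[OF open_image y0(1) C1_\<Psi>, of 1] by auto
  define r where "r = min r1 r2"
  have r: "0 < r" "cball y0 r \<subseteq> cball y0 r1" "cball y0 r \<subseteq> cball y0 r2"
    using r1 r2 by (auto simp: r_def)
  have rO: "cball y0 r \<subseteq> \<Phi> ` U" using r(2) r1(3) by blast
  define M where "M = onorm (D\<Psi> y0) + 1"
  have bl: "bounded_linear (D\<Psi> y0)"
    using linear_derivative[OF C1_\<Psi> y0(1)] by (simp add: linear_conv_bounded_linear)
  have M0: "0 \<le> M" using onorm_pos_le[OF bl] by (simp add: M_def)
  have lip\<Psi>: "norm (\<Psi> y - \<Psi> z) \<le> M * norm (y - z)" if "y \<in> cball y0 r" "z \<in> cball y0 r" for y z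
  proof -
    have "norm (\<Psi> y - \<Psi> z) \<le> norm (\<Psi> y - \<Psi> z - D\<Psi> y0 (y - z)) + norm (D\<Psi> y0 (y - z))"
      using norm_triangle_ineq[of "\<Psi> y - \<Psi> z - D\<Psi> y0 (y - z)" "D\<Psi> y0 (y - z)"] by simp
    also have "\<dots> \<le> norm (y - z) + onorm (D\<Psi> y0) * norm (y - z)"
      using r2(2)[OF subsetD[OF r(3) that(1)] subsetD[OF r(3) that(2)]] onorm[OF bl, of "y - z"]
      by (intro add_mono) auto
    finally show ?thesis by (simp add: M_def algebra_simps)
  qed
  define Z where "Z = {y \<in> cball y0 r \<inter> L. \<forall>t\<in>B. defect t y = 0}"
  have ZE: "\<Psi> y \<in> tangency_set S V \<longleftrightarrow> y \<in> Z" if "y \<in> cball y0 r" "y \<in> L" for y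
    using tangency_iff_defect[OF _ that(2) B(2)] that rO by (auto simp: Z_def)
  have "compact Z"
  proof -
    have "closed {y \<in> cball y0 r. defect t y = 0}" for t
      by (rule continuous_closed_preimage_constant)
         (use C1_on_imp_continuous_on[OF C1_defect] rO in \<open>auto intro: continuous_on_subset\<close>)
    then have "closed (L \<inter> (\<Inter>t\<in>B. {y \<in> cball y0 r. defect t y = 0}))"
      using closed_subspace[OF subspace_L] by (intro closed_Int closed_INT) auto
    then have "compact (cball y0 r \<inter> (L \<inter> (\<Inter>t\<in>B. {y \<in> cball y0 r. defect t y = 0})))"
      by (intro compact_Int_closed) auto
    moreover have "cball y0 r \<inter> (L \<inter> (\<Inter>t\<in>B. {y \<in> cball y0 r. defect t y = 0})) = Z"
      by (auto simp: Z_def)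
    ultimately show ?thesis by simp
  qed
  have est: "norm (y - z) \<le> C * norm (T y - T z)" if "y \<in> Z" "z \<in> Z" for y z
    using that r(2) subspace_diff[OF subspace_L] by (intro chart) (auto simp: Z_def)
  have inj: "inj_on T Z"
    using est by (intro inj_onI) fastforce
  define f where "f s = \<Psi> (inv_into Z T s)" for s
  have fT: "f (T y) = \<Psi> y" if "y \<in> Z" for y
    using inv_into_f_f[OF inj that] by (simp add: f_def)
  have "compact (T ` Z)"
    using \<open>compact Z\<close> T by (intro compact_continuous_image linear_continuous_on) (auto simp: linear_conv_bounded_linear)
  moreover have "(M * C)-lipschitz_on (T ` Z) f"
  proof (rule lipschitz_onI)
    fix s s' assume "s \<in> T ` Z" "s' \<in> T ` Z"
    then obtain y z where yz: "y \<in> Z" "s = T y" "z \<in> Z" "s' = T z" by blast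
    have "norm (\<Psi> y - \<Psi> z) \<le> M * norm (y - z)"
      using yz by (intro lip\<Psi>) (auto simp: Z_def)
    also have "\<dots> \<le> M * (C * norm (T y - T z))"
      using est yz M0 by (intro mult_left_mono) auto
    finally show "dist (f s) (f s') \<le> M * C * dist s s'"
      using yz by (simp add: fT dist_norm mult.assoc)
  qed (use M0 r1 in simp)
  moreover have "open (U \<inter> \<Phi> -` ball y0 r)"
    by (rule continuous_open_preimage[OF C1_on_imp_continuous_on[OF C1_\<Phi>] open_U open_ball])
  moreover have "q \<in> U \<inter> \<Phi> -` ball y0 r" using q(1) r(1) by (simp add: y0_def)
  moreover have "tangency_set S V \<inter> (U \<inter> \<Phi> -` ball y0 r) \<subseteq> f ` T ` Z"
  proof
    fix x assume x: "x \<in> tangency_set S V \<inter> (U \<inter> \<Phi> -` ball y0 r)"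
    then have "\<Phi> x \<in> L" using flat by (auto simp: tangency_set_def)
    moreover have "\<Phi> x \<in> cball y0 r" using x by (auto simp: less_imp_le)
    moreover have "\<Psi> (\<Phi> x) = x" using x inverse by blast
    ultimately have "\<Phi> x \<in> Z" using ZE[of "\<Phi> x"] x by simp
    then have "f (T (\<Phi> x)) = x" using fT \<open>\<Psi> (\<Phi> x) = x\<close> by simp
    then show "x \<in> f ` T ` Z" using \<open>\<Phi> x \<in> Z\<close> by (metis imageI)
  qed
  moreover have "f ` T ` Z \<subseteq> tangency_set S V"
    using ZE fT by (auto simp: Z_def)
  ultimately show ?thesis by blast
qed

end

theorem theorem1p1p1:
  fixes V :: "real ^ 'n \<Rightarrow> (real ^ 'n) set"
    and S :: "(real ^ 'n) set"
    and h k' k :: nat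
  assumes "2 \<le> h" and "h \<le> k'" and "k' \<le> k" and "k < CARD('n)"
    and "CARD('p::finite) = h - 1"
    and "distribution_on 1 UNIV k V"
    and "h_non_involutive h V"
    and "submanifold 2 k' S"
  shows "rectifiable TYPE('p) (tangency_set S V)"
proof (rule rectifiable_if_locally_lipschitz_image)
  fix q assume q: "q \<in> tangency_set S V"
  then have "q \<in> S" by (simp add: tangency_set_def)
  from assms(8)[unfolded submanifold_def, THEN bspec, OF this] obtain U L and \<Phi> \<Psi> :: "real ^ 'n \<Rightarrow> real ^ 'n" where chart: "open U" "q \<in> U" "open (\<Phi> ` U)" "Cr_on 2 U \<Phi>"
    "Cr_on 2 (\<Phi> ` U) \<Psi>" "\<forall>x\<in>U. \<Psi> (\<Phi> x) = x" "subspace L" "dim L = k'"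
    "\<Phi> ` (S \<inter> U) = \<Phi> ` U \<inter> L"
    by (elim exE conjE)
  obtain P :: "real ^ 'n \<Rightarrow> real ^ 'n \<Rightarrow> real ^ 'n" where P: "\<And>x. linear (P x)"
    "\<And>z. Cr_on 1 UNIV (\<lambda>x. P x z)" "\<And>x z. x \<in> UNIV \<Longrightarrow> P x z \<in> V x"
    "\<And>x z. x \<in> UNIV \<Longrightarrow> z \<in> V x \<Longrightarrow> P x z = z"
    using distribution_projection[OF open_UNIV assms(6)] by blast
  interpret C2_flattening_with_projection S U \<Phi> \<Psi> L V P
    by (intro C2_flattening_with_projection.intro C2_flattening.intro
        C2_flattening_with_projection_axioms.intro) (simp_all only: chart P UNIV_I)
  show "\<exists>U (K :: (real ^ 'p) set) f. open U \<and> q \<in> U \<and> compact K \<and>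
      (\<exists>C. C-lipschitz_on K f) \<and> tangency_set S V \<inter> U \<subseteq> f ` K \<and> f ` K \<subseteq> tangency_set S V"
    using assms(5,7) chart(2) q by (intro local_lipschitz_image) (auto simp: h_non_involutive_def)
qed

end
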